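(* Let $a,b,n$ be positive integers. The volume of the matroid polytope of the $(a,b)$-Catalan matroid $C_n^{a,b}$ is $$\operatorname{vol}(\mathcal P(C_n^{a,b}))=\frac{1}{n\,(n(a+b)-1)!}\,A(n(a+b)-1,\,nb),$$ where $A(m,k)$ denotes the Eulerian number, i.e. the number of permutations of $[m]$ with exactly $k-1$ descents.
   Context: For $S\subseteq[N]$, the Schubert matroid $\mathrm{SM}_N(S)$ is the matroid on $[N]$ whose bases are the $T\subseteq[N]$ with $|T|=|S|$ such that for every $i$ the $i$-th smallest element of $T$ is at most the $i$-th smallest element of $S$. The $(a,b)$-Catalan matroid $C_n^{a,b}$ is $\mathrm{SM}_{n(a+b)}(S)$ where $S$ has indicator vector $(0^a,1^b,\dots,0^a,1^b)$ ($n$ blocks of $a$ zeros followed by $b$ ones). For a matroid $M$ on $[N]$, $\mathcal P(M)=\mathrm{conv}\{e_B: B\text{ a basis of }M\}\subset\mathbb R^N$. The polytope $\mathcal P(C_n^{a,b})$ lies in the hyperplane $\{\sum_i x_i=nb\}$ of $\mathbb R^N$, $N=n(a+b)$; its volume is the $(N-1)$-dimensional volume in this hyperplane, normalized so that a fundamental domain of the lattice $\{x\in\mathbb Z^N:\sum_i x_i=0\}$ has volume $1$ (equivalently, the Lebesgue volume of the projection of the polytope to the first $N-1$ coordinates; equivalently, the coefficient of $t^{N-1}$ in its Ehrhart polynomial). *)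

theory Defs
  imports "HOL-Analysis.Analysis" "HOL-Combinatorics.Permutations"
begin

text \<open>A matroid is represented by its ground set together with its set of bases.\<close>

type_synonym 'a matroid = "'a set \<times> 'a set set"

definition bases :: "'a matroid \<Rightarrow> 'a set set" where
  "bases M = snd M"

text \<open>The list \<open>sorted_list_of_set T\<close> is indexed from 0, so its entry at \<open>i\<close> is the
  \<open>(i + 1)\<close>-st smallest element of \<open>T\<close>.\<close>

definition schubert_matroid :: "nat \<Rightarrow> nat set \<Rightarrow> nat matroid" where
  "schubert_matroid N S =
    ({1..N},
     {T. T \<subseteq> {1..N} \<and> card T = card S \<and>
         (\<forall>i < card S. sorted_list_of_set T ! i \<le> sorted_list_of_set S ! i)})"

definition catalan_word :: "nat \<Rightarrow> nat \<Rightarrow> nat \<Rightarrow> nat list" where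
  "catalan_word n a b = concat (replicate n (replicate a 0 @ replicate b 1))"

definition catalan_matroid :: "nat \<Rightarrow> nat \<Rightarrow> nat \<Rightarrow> nat matroid" where
  "catalan_matroid n a b =
    schubert_matroid (n * (a + b)) {i \<in> {1..n * (a + b)}. catalan_word n a b ! (i - 1) = 1}"

text \<open>Since the dimension varies, a point of the space of real vectors indexed by a set \<open>E\<close>
  is a function \<open>'a \<Rightarrow> real\<close> vanishing outside \<open>E\<close>. The library's \<^term>\<open>convex hull V\<close> is not
  applicable, because function types are not instances of the class \<open>real_vector\<close>.\<close>

definition conv :: "('a \<Rightarrow> real) set \<Rightarrow> ('a \<Rightarrow> real) set" where
  "conv V = {x. \<exists>F w. finite F \<and> F \<subseteq> V \<and> (\<forall>v\<in>F. 0 \<le> w v) \<and> sum w F = 1 \<and>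
                      x = (\<lambda>i. \<Sum>v\<in>F. w v * v i)}"

definition matroid_polytope :: "'a matroid \<Rightarrow> ('a \<Rightarrow> real) set" where
  "matroid_polytope M = conv {indicator B | B. B \<in> bases M}"

text \<open>The \<open>(N - 1)\<close>-dimensional volume of a subset \<open>P\<close> of a hyperplane
  \<open>{x. (\<Sum>i\<in>{1..N}. x i) = c}\<close>, normalized so that a fundamental domain of the lattice of
  integer points with coordinate sum 0 has volume 1. Dropping the last coordinate maps this
  lattice isomorphically onto the integer lattice of the first \<open>N - 1\<close> coordinates, so this is
  the Lebesgue measure of the projection. The use of \<^const>\<open>restrict\<close> (value \<open>undefined\<close>
  outside \<open>{1..N - 1}\<close>) matches the carrier of the product measure.\<close>

definition hyperplane_volume :: "nat \<Rightarrow> (nat \<Rightarrow> real) set \<Rightarrow> real" where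
  "hyperplane_volume N P =
    measure (Pi\<^sub>M {1..N - 1} (\<lambda>_. lborel)) ((\<lambda>x. restrict x {1..N - 1}) ` P)"

definition descents :: "nat \<Rightarrow> (nat \<Rightarrow> nat) \<Rightarrow> nat set" where
  "descents m p = {i \<in> {1..<m}. p i > p (i + 1)}"

text \<open>The condition \<open>card (descents m p) + 1 = k\<close> says ``exactly \<open>k - 1\<close> descents'' without
  truncated subtraction at \<open>k = 0\<close>.\<close>

definition eulerian :: "nat \<Rightarrow> nat \<Rightarrow> nat" where
  "eulerian m k = card {p. p permutes {1..m} \<and> card (descents m p) + 1 = k}"

end

theory Submission
  imports Defs
begin

text \<open>
  The matroid polytope consists of the points of the hypersimplex
  $\{x \in [0,1]^N : \sum_i x_i = nb\}$ whose prefix sums $s_{j(a+b)}$ are at least $jb$: for a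
  point of the latter set, the roundings $\lfloor s_k + \theta\rfloor$ with a uniformly random
  $\theta \in [0,1)$ are the prefix counts of a random basis whose expected indicator vector is
  $x$. The map sending $x$ to the fractional parts of its prefix sums preserves Lebesgue measure
  on the cube (Stanley), and $\lfloor s_k\rfloor$ becomes the number of descents among the first
  $k$ fractional parts. All orderings of the coordinates are equally likely, so the volume is the
  number of permutations of $[N-1]$ with $nb - 1$ descents and at least $jb$ descents among the
  first $j(a+b)$ entries, divided by $(N-1)!$. Lifting the cyclic word $0\,p_1 \cdots p_{N-1}$ to
  a quasi-periodic sequence of integers, the cycle lemma shows that exactly one of its $n$
  rotations by multiples of $a+b$ satisfies the prefix condition; it is unique because the values
  are distinct modulo $N$.
\<close>

text \<open>The cycle lemma needs a total that splits evenly over the n blocks, and the shift by one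
  in the descent number supplies it. The last coordinate lies in [0,1], so dropping it confines the
  sum of the other N - 1 to [nb - 1, nb]; almost everywhere the floor of that sum, hence the descent
  number, is nb - 1. The cyclic word winds once more, because the step from its last entry back to 0
  always wraps. So a lift gains exactly nb * N per period, an average of b * N per block.

  Descent counts of a cyclic word at the block ends, compared with jb, can tie at their minimum and
  then single out no starting point. A lift is N times the count plus a residue in [0, N): distinct
  residues break the ties, yet being at least jb * N still means having at least jb descents. Lifts
  also absorb the renormalization after a rotation, where the new first entry must be subtracted
  modulo N to become 0 again.\<close>

declare One_nat_def [simp del]

subsection \<open>Fractional parts of partial sums and order cells of the unit cube\<close>

interpretation lborel_PiM: product_sigma_finite "\<lambda>_::nat. lborel :: real measure"
  by standard

text \<open>Integrate coordinate \<open>i\<close> first: by Fubini the countable sections contribute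
  0. It is used for hyperplanes that a line in direction \<open>i\<close> meets at most once, namely
  ties between coordinates and boundary faces.\<close>

lemma null_sets_PiM_countable_sections:
  fixes S :: "(nat \<Rightarrow> real) set"
  assumes "finite I" "i \<in> I" and S: "S \<in> sets (Pi\<^sub>M I (\<lambda>_. lborel))"
    and countable: "\<And>x. countable {t. x(i := t) \<in> S}"
  shows "S \<in> null_sets (Pi\<^sub>M I (\<lambda>_. lborel))"
proof -
  have I: "insert i (I - {i}) = I" using assms by auto
  have zero: "(\<integral>\<^sup>+ t. indicator S (x(i := t)) \<partial>lborel) = 0" for x :: "nat \<Rightarrow> real"
  proof -
    have "AE t in lborel. indicator S (x(i := t)) = (0 :: ennreal)"
      by (rule AE_I'[OF countable_imp_null_set_lborel[OF countable[of x]]])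
        (auto simp: indicator_def)
    then show ?thesis
      by (simp add: nn_integral_0_iff_AE cong: nn_integral_cong_AE)
  qed
  have "emeasure (Pi\<^sub>M I (\<lambda>_. lborel)) S = (\<integral>\<^sup>+ x. indicator S x \<partial>(Pi\<^sub>M (insert i (I - {i})) (\<lambda>_. lborel)))"
    using S by (simp only: I nn_integral_indicator)
  also have "\<dots> = (\<integral>\<^sup>+ x. (\<integral>\<^sup>+ t. indicator S (x(i := t)) \<partial>lborel) \<partial>(Pi\<^sub>M (I - {i}) (\<lambda>_. lborel)))"
    using assms(1) S by (intro lborel_PiM.product_nn_integral_insert) (auto simp only: I finite_Diff borel_measurable_indicator)
  also have "\<dots> = 0" by (simp add: zero)
  finally show ?thesis using S by (intro null_setsI) auto
qed

lemma frac_add_cases: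
  fixes r t :: real
  assumes "0 \<le> r" "r < 1" "0 \<le> t" "t < 1"
  shows "frac (r + t) = (if t < 1 - r then r + t else r + t - 1)"
  using assms by (auto simp: frac_unique_iff)

text \<open>A rotation of the circle preserves length. Only \<open>r = frac c\<close> matters: cut
  [0,1) at 1 - r; the lower piece moves up by r onto [r,1), the upper piece moves down by 1 - r onto
  [0,r).\<close>

lemma nn_integral_frac_shift:
  fixes c :: real
  assumes [measurable]: "f \<in> borel_measurable borel"
  shows "(\<integral>\<^sup>+ t. f (frac (c + t)) * indicator {0..<1} t \<partial>lborel) =
    (\<integral>\<^sup>+ t. f t * indicator {0..<1} t \<partial>lborel)"
proof -
  define r where "r = frac c"
  have r: "0 \<le> r" "r < 1" by (auto simp: r_def frac_lt_1)
  have "frac (c + t) = frac (r + t)" for t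
  proof -
    have "c + t = (r + t) + of_int \<lfloor>c\<rfloor>" by (simp add: r_def frac_def)
    then show ?thesis by (simp only: frac_add_of_int_right)
  qed
  \<comment> \<open>The factor \<open>1 *\<close> gives both integrands the shape of the affine
    substitution rule, with shifts \<open>r\<close> and \<open>r - 1\<close>.\<close>
  then have "(\<integral>\<^sup>+ t. f (frac (c + t)) * indicator {0..<1} t \<partial>lborel) =
      (\<integral>\<^sup>+ t. f (r + 1 * t) * indicator {r..<1} (r + 1 * t) +
        f ((r - 1) + 1 * t) * indicator {0..<r} ((r - 1) + 1 * t) \<partial>lborel)"
    using r by (intro nn_integral_cong) (auto simp: indicator_def frac_add_cases algebra_simps)
  also have "\<dots> = (\<integral>\<^sup>+ t. f (r + 1 * t) * indicator {r..<1} (r + 1 * t) \<partial>lborel) +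
      (\<integral>\<^sup>+ t. f ((r - 1) + 1 * t) * indicator {0..<r} ((r - 1) + 1 * t) \<partial>lborel)"
    by (intro nn_integral_add) auto
  also have "\<dots> = (\<integral>\<^sup>+ t. f t * indicator {r..<1} t \<partial>lborel) + (\<integral>\<^sup>+ t. f t * indicator {0..<r} t \<partial>lborel)"
    using nn_integral_real_affine[of "\<lambda>t. f t * indicator {r..<1} t" 1 r]
      nn_integral_real_affine[of "\<lambda>t. f t * indicator {0..<r} t" 1 "r - 1"] by simp
  also have "\<dots> = (\<integral>\<^sup>+ t. f t * indicator {r..<1} t + f t * indicator {0..<r} t \<partial>lborel)"
    by (intro nn_integral_add[symmetric]) auto
  also have "\<dots> = (\<integral>\<^sup>+ t. f t * indicator {0..<1} t \<partial>lborel)"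
    using r by (intro nn_integral_cong) (auto simp: indicator_def)
  finally show ?thesis .
qed

section \<open>The measure-preserving map to fractional parts of prefix sums\<close>

text \<open>Half-open, so that the cube is exactly the range of fractional parts and each coordinate
  adds a carry of at most 1 to a floor.\<close>

definition unit_cube :: "nat \<Rightarrow> (nat \<Rightarrow> real) set" where
  "unit_cube m = (\<Pi>\<^sub>E i\<in>{1..m}. {0..<1})"

definition frac_sums :: "nat \<Rightarrow> (nat \<Rightarrow> real) \<Rightarrow> nat \<Rightarrow> real" where
  "frac_sums m x = (\<lambda>k\<in>{1..m}. frac (\<Sum>i=1..k. x i))"

abbreviation cube_measure :: "nat \<Rightarrow> (nat \<Rightarrow> real) measure" where
  "cube_measure m \<equiv> Pi\<^sub>M {1..m} (\<lambda>_. lborel)"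

lemma unit_cube_measurable [measurable]: "unit_cube m \<in> sets (cube_measure m)"
  by (auto simp: unit_cube_def intro!: sets_PiM_I_finite)

lemma unit_cube_subset_space: "unit_cube m \<subseteq> space (cube_measure m)"
  by (rule sets.sets_into_space) measurable

lemma emeasure_unit_cube: "emeasure (cube_measure m) (unit_cube m) = 1"
  unfolding unit_cube_def by (subst lborel_PiM.emeasure_PiM) auto

lemma frac_measurable [measurable]: "frac \<in> borel_measurable (borel :: real measure)"
  unfolding frac_def by measurable

lemma frac_sums_measurable [measurable]: "frac_sums m \<in> measurable (cube_measure m) (cube_measure m)"
  unfolding frac_sums_def
proof (rule measurable_restrict)
  fix k assume "k \<in> {1..m}"
  then have "(\<lambda>x. \<Sum>i=1..k. x i) \<in> borel_measurable (cube_measure m)"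
    by (intro borel_measurable_sum measurable_component_singleton[where M = "\<lambda>_. lborel", simplified]) auto
  then show "(\<lambda>x. frac (\<Sum>i=1..k. x i)) \<in> measurable (cube_measure m) lborel"
    using measurable_compose[OF _ frac_measurable] by simp
qed

lemma indicator_unit_cube_Suc:
  assumes "x \<in> space (cube_measure m)"
  shows "indicator (unit_cube (Suc m)) (x(Suc m := t)) =
    (indicator (unit_cube m) x * indicator {0..<1} t :: ennreal)"
proof -
  have ext: "x \<in> extensional {1..m}" using assms by (simp add: space_PiM PiE_iff)
  then have "x(Suc m := t) \<in> extensional {1..Suc m}" by (auto simp: extensional_def)
  moreover have "(\<forall>i\<in>{1..Suc m}. (x(Suc m := t)) i \<in> {0..<1}) \<longleftrightarrow>
      (\<forall>i\<in>{1..m}. x i \<in> {0..<1}) \<and> t \<in> {0..<1}"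
    by (simp add: atLeastAtMostSuc_conv Ball_def) fastforce
  ultimately have "x(Suc m := t) \<in> unit_cube (Suc m) \<longleftrightarrow> x \<in> unit_cube m \<and> t \<in> {0..<1}"
    using ext unfolding unit_cube_def PiE_iff by blast
  then show ?thesis by (auto simp: indicator_def)
qed

text \<open>The map is triangular: the new coordinate enters only the last entry, where it is
  rotated by the sum of the earlier ones.\<close>

lemma frac_sums_Suc:
  assumes "x \<in> space (cube_measure m)"
  shows "frac_sums (Suc m) (x(Suc m := t)) =
    (frac_sums m x)(Suc m := frac ((\<Sum>i=1..m. x i) + t))"
proof
  fix k
  have sums: "(\<Sum>i=1..j. (x(Suc m := t)) i) = (\<Sum>i=1..j. x i)" if "j \<le> m" for j
    using that by (intro sum.cong) auto
  consider "k \<in> {1..m}" | "k = Suc m" | "k \<notin> {1..Suc m}" by fastforce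
  then show "frac_sums (Suc m) (x(Suc m := t)) k =
    ((frac_sums m x)(Suc m := frac ((\<Sum>i=1..m. x i) + t))) k"
  proof cases
    case 1
    then have "frac_sums (Suc m) (x(Suc m := t)) k = frac (\<Sum>i=1..k. x i)"
      unfolding frac_sums_def using sums[of k] by simp
    then show ?thesis using 1 by (simp add: frac_sums_def)
  next
    case 2
    have "(\<Sum>i=1..Suc m. (x(Suc m := t)) i) = (\<Sum>i=1..m. x i) + t"
      using sums[of m] by simp
    then show ?thesis unfolding frac_sums_def 2 by simp
  next
    case 3
    then show ?thesis unfolding frac_sums_def by auto
  qed
qed

lemma measurable_fun_upd_Suc:
  assumes "x \<in> space (cube_measure m)"
  shows "(\<lambda>t. x(Suc m := t)) \<in> measurable borel (cube_measure (Suc m))"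
proof -
  have "(\<lambda>t. x(Suc m := t)) \<in> measurable borel (Pi\<^sub>M (insert (Suc m) {1..m}) (\<lambda>_. lborel :: real measure))"
    using assms by (intro measurable_fun_upd[where J = "{1..m}"]) auto
  then show ?thesis by (simp add: atLeastAtMostSuc_conv)
qed

text \<open>Induction on the dimension. With the earlier coordinates fixed, the last one undergoes a
  mere rotation, so integrating it out leaves \<open>h (frac_sums m x)\<close>. The claim concerns
  all measurable functions, not only sets, because the induction hypothesis is applied to the inner
  integral \<open>h\<close>.\<close>

lemma nn_integral_frac_sums:
  assumes "f \<in> borel_measurable (cube_measure m)"
  shows "(\<integral>\<^sup>+ x. f (frac_sums m x) * indicator (unit_cube m) x \<partial>cube_measure m) =
    (\<integral>\<^sup>+ x. f x * indicator (unit_cube m) x \<partial>cube_measure m)"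
  using assms
proof (induction m arbitrary: f)
  case 0
  have "frac_sums 0 x = x" if "x \<in> unit_cube 0" for x
    using that by (auto simp: frac_sums_def unit_cube_def fun_eq_iff)
  then show ?case by (intro nn_integral_cong) (auto simp: indicator_def)
next
  case (Suc m)
  note [measurable] = Suc.prems
  have I: "{1..Suc m} = insert (Suc m) {1..m}" by auto
  have split: "integral\<^sup>N (cube_measure (Suc m)) g =
      (\<integral>\<^sup>+ x. (\<integral>\<^sup>+ t. g (x(Suc m := t)) \<partial>lborel) \<partial>cube_measure m)"
    if "g \<in> borel_measurable (cube_measure (Suc m))" for g
    using that unfolding I by (intro lborel_PiM.product_nn_integral_insert) auto
  define h where "h x = (\<integral>\<^sup>+ t. f (x(Suc m := t)) * indicator {0..<1} t \<partial>lborel)" for x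
  have "(\<lambda>p. (fst p)(Suc m := snd p)) \<in> measurable (cube_measure m \<Otimes>\<^sub>M lborel) (cube_measure (Suc m))"
    unfolding I using measurable_add_dim[of "Suc m" "{1..m}" "\<lambda>_. lborel :: real measure"]
    by (simp add: case_prod_beta')
  then have [measurable]: "h \<in> borel_measurable (cube_measure m)"
    unfolding h_def by measurable
  have "(\<integral>\<^sup>+ x. f (frac_sums (Suc m) x) * indicator (unit_cube (Suc m)) x \<partial>cube_measure (Suc m)) =
      (\<integral>\<^sup>+ x. h (frac_sums m x) * indicator (unit_cube m) x \<partial>cube_measure m)"
  proof (subst split)
    show "(\<integral>\<^sup>+ x. (\<integral>\<^sup>+ t. f (frac_sums (Suc m) (x(Suc m := t))) *
        indicator (unit_cube (Suc m)) (x(Suc m := t)) \<partial>lborel) \<partial>cube_measure m) =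
      (\<integral>\<^sup>+ x. h (frac_sums m x) * indicator (unit_cube m) x \<partial>cube_measure m)"
    proof (rule nn_integral_cong)
      fix x assume x: "x \<in> space (cube_measure m)"
      have fx: "frac_sums m x \<in> space (cube_measure m)"
        using measurable_space[OF frac_sums_measurable x] .
      have [measurable]: "(\<lambda>t. f ((frac_sums m x)(Suc m := t))) \<in> borel_measurable borel"
        by (rule measurable_compose[OF measurable_fun_upd_Suc[OF fx] Suc.prems])
      have "(\<integral>\<^sup>+ t. f (frac_sums (Suc m) (x(Suc m := t))) *
          indicator (unit_cube (Suc m)) (x(Suc m := t)) \<partial>lborel) =
        (\<integral>\<^sup>+ t. (f ((frac_sums m x)(Suc m := frac ((\<Sum>i=1..m. x i) + t))) * indicator {0..<1} t)
          * indicator (unit_cube m) x \<partial>lborel)"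
        using x by (intro nn_integral_cong) (simp only: frac_sums_Suc indicator_unit_cube_Suc ac_simps)
      also have "\<dots> = (\<integral>\<^sup>+ t. (f ((frac_sums m x)(Suc m := frac ((\<Sum>i=1..m. x i) + t))) * indicator {0..<1} t) \<partial>lborel)
          * indicator (unit_cube m) x"
        by (rule nn_integral_multc) measurable
      also have "\<dots> = h (frac_sums m x) * indicator (unit_cube m) x"
        unfolding h_def
        by (subst nn_integral_frac_shift[where f = "\<lambda>s. f ((frac_sums m x)(Suc m := s))"]) auto
      finally show "(\<integral>\<^sup>+ t. f (frac_sums (Suc m) (x(Suc m := t))) *
          indicator (unit_cube (Suc m)) (x(Suc m := t)) \<partial>lborel) = 
        h (frac_sums m x) * indicator (unit_cube m) x" .
    qed
  qed measurable
  also have "\<dots> = (\<integral>\<^sup>+ x. h x * indicator (unit_cube m) x \<partial>cube_measure m)"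
    by (rule Suc.IH) measurable
  also have "\<dots> = (\<integral>\<^sup>+ x. f x * indicator (unit_cube (Suc m)) x \<partial>cube_measure (Suc m))"
  proof (subst split)
    show "(\<integral>\<^sup>+ x. h x * indicator (unit_cube m) x \<partial>cube_measure m) =
      (\<integral>\<^sup>+ x. (\<integral>\<^sup>+ t. f (x(Suc m := t)) * indicator (unit_cube (Suc m)) (x(Suc m := t)) \<partial>lborel) \<partial>cube_measure m)"
    proof (rule nn_integral_cong)
      fix x assume x: "x \<in> space (cube_measure m)"
      have [measurable]: "(\<lambda>t. f (x(Suc m := t))) \<in> borel_measurable borel"
        by (rule measurable_compose[OF measurable_fun_upd_Suc[OF x] Suc.prems])
      have "(\<integral>\<^sup>+ t. f (x(Suc m := t)) * indicator (unit_cube (Suc m)) (x(Suc m := t)) \<partial>lborel) =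
        (\<integral>\<^sup>+ t. (f (x(Suc m := t)) * indicator {0..<1} t) * indicator (unit_cube m) x \<partial>lborel)"
        using x by (intro nn_integral_cong) (simp only: indicator_unit_cube_Suc ac_simps)
      also have "\<dots> = h x * indicator (unit_cube m) x"
        unfolding h_def by (rule nn_integral_multc) measurable
      finally show "h x * indicator (unit_cube m) x = (\<integral>\<^sup>+ t. f (x(Suc m := t)) *
          indicator (unit_cube (Suc m)) (x(Suc m := t)) \<partial>lborel)" by simp
    qed
  qed measurable
  finally show ?case .
qed

lemma measure_frac_sums_vimage:
  assumes [measurable]: "E \<in> sets (cube_measure m)"
  shows "measure (cube_measure m) {x \<in> unit_cube m. frac_sums m x \<in> E} =
    measure (cube_measure m) (unit_cube m \<inter> E)"
proof -
  have cube: "x \<in> space (cube_measure m)" if "x \<in> unit_cube m" for x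
    using unit_cube_subset_space that by blast
  have eq: "{x \<in> unit_cube m. frac_sums m x \<in> E} =
      unit_cube m \<inter> (frac_sums m -` E \<inter> space (cube_measure m))"
    using cube by auto
  have 1: "{x \<in> unit_cube m. frac_sums m x \<in> E} \<in> sets (cube_measure m)"
    unfolding eq by measurable
  have "emeasure (cube_measure m) {x \<in> unit_cube m. frac_sums m x \<in> E} =
      (\<integral>\<^sup>+ x. indicator E (frac_sums m x) * indicator (unit_cube m) x \<partial>cube_measure m)"
    unfolding nn_integral_indicator[OF 1, symmetric]
    by (rule nn_integral_cong) (auto simp: indicator_def)
  also have "\<dots> = (\<integral>\<^sup>+ x. indicator E x * indicator (unit_cube m) x \<partial>cube_measure m)"
    by (rule nn_integral_frac_sums) measurable
  also have "\<dots> = (\<integral>\<^sup>+ x. indicator (unit_cube m \<inter> E) x \<partial>cube_measure m)"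
    by (auto intro!: nn_integral_cong simp: indicator_def)
  also have "\<dots> = emeasure (cube_measure m) (unit_cube m \<inter> E)"
    by (rule nn_integral_indicator) measurable
  finally show ?thesis by (simp add: measure_def)
qed

section \<open>Order cells of the cube and their volume\<close>

text \<open>For injective \<open>p\<close> the equivalence over all pairs forces distinct
  coordinates, so points with ties lie in no cell of a permutation.\<close>

definition order_cell :: "nat \<Rightarrow> (nat \<Rightarrow> nat) \<Rightarrow> (nat \<Rightarrow> real) set" where
  "order_cell m p = {y \<in> unit_cube m. \<forall>i\<in>{1..m}. \<forall>j\<in>{1..m}. y i < y j \<longleftrightarrow> p i < p j}"

lemma order_cell_measurable [measurable]: "order_cell m p \<in> sets (cube_measure m)"
proof -
  have "order_cell m p = unit_cube m \<inter>
      {y \<in> space (cube_measure m). \<forall>i\<in>{1..m}. \<forall>j\<in>{1..m}. y i < y j \<longleftrightarrow> p i < p j}"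
    using unit_cube_subset_space unfolding order_cell_def by blast
  also have "\<dots> \<in> sets (cube_measure m)" by measurable
  finally show ?thesis .
qed

text \<open>The product measure is determined by boxes, and permuting coordinates turns a box into a
  box with the same sides in another order.\<close>

lemma distr_PiM_lborel_permutes:
  assumes p: "p permutes I" and "finite I"
  shows "distr (Pi\<^sub>M I (\<lambda>_. lborel)) (Pi\<^sub>M I (\<lambda>_. lborel)) (\<lambda>x. \<lambda>i\<in>I. x (p i)) =
    Pi\<^sub>M I (\<lambda>_::nat. lborel :: real measure)"
proof (rule lborel_PiM.PiM_eqI)
  fix A :: "nat \<Rightarrow> real set" assume A: "\<And>i. i \<in> I \<Longrightarrow> A i \<in> sets lborel"
  have in_I: "p i \<in> I" "inv p i \<in> I" if "i \<in> I" for i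
    using that permutes_in_image[OF p] permutes_in_image[OF permutes_inv[OF p]] by simp_all
  have meas: "(\<lambda>x. \<lambda>i\<in>I. x (p i)) \<in> measurable (Pi\<^sub>M I (\<lambda>_. lborel)) (Pi\<^sub>M I (\<lambda>_. lborel :: real measure))"
    using in_I by (intro measurable_restrict) auto
  have "emeasure (distr (Pi\<^sub>M I (\<lambda>_. lborel)) (Pi\<^sub>M I (\<lambda>_. lborel)) (\<lambda>x. \<lambda>i\<in>I. x (p i))) (Pi\<^sub>E I A) =
      emeasure (Pi\<^sub>M I (\<lambda>_. lborel)) ((\<lambda>x. \<lambda>i\<in>I. x (p i)) -` Pi\<^sub>E I A \<inter> space (Pi\<^sub>M I (\<lambda>_. lborel)))"
    using A assms(2) by (intro emeasure_distr meas sets_PiM_I_finite) auto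
  also have "(\<lambda>x. \<lambda>i\<in>I. x (p i)) -` Pi\<^sub>E I A \<inter> space (Pi\<^sub>M I (\<lambda>_. lborel)) = Pi\<^sub>E I (\<lambda>i. A (inv p i))"
  proof -
    have "(\<forall>i\<in>I. x (p i) \<in> A i) \<longleftrightarrow> (\<forall>i\<in>I. x i \<in> A (inv p i))" for x :: "nat \<Rightarrow> real"
      using in_I permutes_inverses[OF p] by metis
    then show ?thesis using in_I by (auto simp: space_PiM PiE_iff)
  qed
  also have "emeasure (Pi\<^sub>M I (\<lambda>_. lborel)) \<dots> = (\<Prod>i\<in>I. emeasure lborel (A (inv p i)))"
    using A in_I assms(2) by (intro lborel_PiM.emeasure_PiM) auto
  also have "\<dots> = (\<Prod>i\<in>I. emeasure lborel (A i))"
    using prod.permute[OF permutes_inv[OF p], of "\<lambda>i. emeasure lborel (A i)"] by (simp add: o_def)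
  finally show "emeasure (distr (Pi\<^sub>M I (\<lambda>_. lborel)) (Pi\<^sub>M I (\<lambda>_. lborel)) (\<lambda>x. \<lambda>i\<in>I. x (p i))) (Pi\<^sub>E I A) =
    (\<Prod>i\<in>I. emeasure lborel (A i))" .
qed (use assms in auto)

text \<open>Composing points with \<open>p\<close> preserves the measure. Pulled back this way, the
  cell of \<open>p\<close> compares \<open>x (p i)\<close> with \<open>p i\<close>; renaming
  \<open>p i\<close> to \<open>i\<close> leaves the cell of the identity.\<close>

lemma emeasure_order_cell_eq_id:
  assumes p: "p permutes {1..m}"
  shows "emeasure (cube_measure m) (order_cell m p) = emeasure (cube_measure m) (order_cell m id)"
proof -
  let ?h = "\<lambda>x::nat \<Rightarrow> real. \<lambda>i\<in>{1..m}. x (p i)"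
  have in_I: "p i \<in> {1..m}" "inv p i \<in> {1..m}" if "i \<in> {1..m}" for i
    using that permutes_in_image[OF p] permutes_in_image[OF permutes_inv[OF p]] by simp_all
  have meas: "?h \<in> measurable (cube_measure m) (cube_measure m)"
    using in_I by (intro measurable_restrict) auto
  have "emeasure (cube_measure m) (order_cell m p) =
      emeasure (distr (cube_measure m) (cube_measure m) ?h) (order_cell m p)"
    by (simp add: distr_PiM_lborel_permutes[OF p])
  also have "\<dots> = emeasure (cube_measure m) (?h -` order_cell m p \<inter> space (cube_measure m))"
    by (rule emeasure_distr[OF meas]) measurable
  also have "?h -` order_cell m p \<inter> space (cube_measure m) = order_cell m id"
  proof -
    have 1: "(\<forall>i\<in>{1..m}. x (p i) \<in> {0..<1}) \<longleftrightarrow> (\<forall>i\<in>{1..m}. x i \<in> {0..<1})" for x :: "nat \<Rightarrow> real"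
      using in_I permutes_inverses[OF p] by metis
    have 2: "(\<forall>i\<in>{1..m}. \<forall>j\<in>{1..m}. x (p i) < x (p j) \<longleftrightarrow> p i < p j) \<longleftrightarrow>
      (\<forall>i\<in>{1..m}. \<forall>j\<in>{1..m}. x i < x j \<longleftrightarrow> i < j)" for x :: "nat \<Rightarrow> real"
      using in_I permutes_inverses[OF p] by metis
    have "x \<in> ?h -` order_cell m p \<inter> space (cube_measure m) \<longleftrightarrow> x \<in> order_cell m id" for x
      unfolding order_cell_def unit_cube_def using 1[of x] 2[of x]
      by (simp add: space_PiM PiE_iff) blast
    then show ?thesis by blast
  qed
  finally show ?thesis .
qed

lemma order_cell_exists:
  assumes y: "y \<in> unit_cube m" and inj: "inj_on y {1..m}"
  shows "\<exists>p. p permutes {1..m} \<and> y \<in> order_cell m p"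
proof -
  \<comment> \<open>The rank of \<open>y i\<close> among the coordinates; outside the index set
    \<open>permutes\<close> demands the identity.\<close>
  define r where "r i = (if i \<in> {1..m} then card {j\<in>{1..m}. y j \<le> y i} else i)" for i
  have less: "y i < y j \<longleftrightarrow> r i < r j" if "i \<in> {1..m}" "j \<in> {1..m}" for i j
  proof -
    have *: "r i < r j" if "i \<in> {1..m}" "j \<in> {1..m}" "y i < y j" for i j
    proof -
      have "{k\<in>{1..m}. y k \<le> y i} \<subset> {k\<in>{1..m}. y k \<le> y j}"
      proof
        show "{k\<in>{1..m}. y k \<le> y i} \<subseteq> {k\<in>{1..m}. y k \<le> y j}" using that by auto
        have "j \<in> {k\<in>{1..m}. y k \<le> y j} - {k\<in>{1..m}. y k \<le> y i}" using that by auto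
        then show "{k\<in>{1..m}. y k \<le> y i} \<noteq> {k\<in>{1..m}. y k \<le> y j}" by blast
      qed
      then have "card {k\<in>{1..m}. y k \<le> y i} < card {k\<in>{1..m}. y k \<le> y j}"
        by (intro psubset_card_mono) simp_all
      then show ?thesis using that by (simp add: r_def)
    qed
    have "y i = y j \<Longrightarrow> i = j" using inj that by (auto dest: inj_onD)
    then show ?thesis using *[OF that] *[OF that(2,1)] by (cases "y i" "y j" rule: linorder_cases) auto
  qed
  have "inj_on r {1..m}"
  proof (rule inj_onI)
    fix i j assume "i \<in> {1..m}" "j \<in> {1..m}" "r i = r j"
    then have "y i = y j" using less[of i j] less[of j i] by simp
    then show "i = j" using inj \<open>i \<in> {1..m}\<close> \<open>j \<in> {1..m}\<close> by (auto dest: inj_onD)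
  qed
  moreover have "r ` {1..m} \<subseteq> {1..m}"
  proof
    fix k assume "k \<in> r ` {1..m}"
    then obtain i where i: "i \<in> {1..m}" "k = card {j\<in>{1..m}. y j \<le> y i}" by (auto simp: r_def)
    have "k \<le> card {1..m}" unfolding i by (intro card_mono) auto
    moreover have "k > 0" unfolding i using i(1) by (subst card_gt_0_iff) auto
    ultimately show "k \<in> {1..m}" by auto
  qed
  ultimately have "bij_betw r {1..m} {1..m}"
    by (simp add: bij_betw_def endo_inj_surj)
  then have "r permutes {1..m}" by (rule bij_imp_permutes) (auto simp: r_def)
  with less y show ?thesis by (auto simp: order_cell_def)
qed

text \<open>A point determines its permutation: \<open>p i\<close> is one more than the number of
  coordinates below \<open>y i\<close>.\<close>

lemma order_cell_disjoint:
  assumes p: "p permutes {1..m}" and q: "q permutes {1..m}" and "p \<noteq> q"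
  shows "order_cell m p \<inter> order_cell m q = {}"
proof (rule ccontr)
  assume "\<not> ?thesis"
  then obtain y where y: "y \<in> order_cell m p" "y \<in> order_cell m q" by auto
  have rank: "s i = card {j\<in>{1..m}. y j < y i} + 1"
    if s: "s permutes {1..m}" "y \<in> order_cell m s" and i: "i \<in> {1..m}" for s i
  proof -
    have "card {j\<in>{1..m}. y j < y i} = card {j\<in>{1..m}. s j < s i}"
      using s i by (intro arg_cong[where f = card]) (auto simp: order_cell_def)
    also have "card {j\<in>{1..m}. s j < s i} = card (s ` {j\<in>{1..m}. s j < s i})"
      using permutes_inj[OF s(1)] by (intro card_image[symmetric]) (auto intro: inj_on_subset)
    also have "s ` {j\<in>{1..m}. s j < s i} = {1..<s i}"
    proof -
      have "s i \<in> {1..m}" using permutes_in_image[OF s(1)] i by blast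
      then have "k \<in> s ` {1..m}" if "k \<in> {1..<s i}" for k
        using that permutes_image[OF s(1)] by auto
      moreover have "s j \<ge> 1" if "j \<in> {1..m}" for j
        using permutes_in_image[OF s(1), of j] that by auto
      ultimately show ?thesis by fastforce
    qed
    finally have "card {j\<in>{1..m}. y j < y i} = s i - 1" by simp
    moreover have "s i \<in> {1..m}" using permutes_in_image[OF s(1), of i] i by blast
    ultimately show ?thesis by simp
  qed
  have "p i = q i" for i
    using rank[OF p y(1), of i] rank[OF q y(2), of i] permutes_not_in[OF p, of i] permutes_not_in[OF q, of i]
    by metis
  then show False using \<open>p \<noteq> q\<close> by auto
qed

lemma AE_inj_on: "AE y in cube_measure m. inj_on y {1..m}"
proof -
  have "AE y in cube_measure m. y i \<noteq> y j" if "i \<in> {1..m}" "j \<in> {1..m}" "i \<noteq> j" for i j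
  proof (rule AE_I'[of "{y \<in> space (cube_measure m). y i = y j}"])
    show "{y \<in> space (cube_measure m). y i = y j} \<in> null_sets (cube_measure m)"
    proof (rule null_sets_PiM_countable_sections)
      show "{y \<in> space (cube_measure m). y i = y j} \<in> sets (cube_measure m)"
        using that by measurable
      fix x :: "nat \<Rightarrow> real"
      have "{t. x(i := t) \<in> {y \<in> space (cube_measure m). y i = y j}} \<subseteq> {x j}" using that by auto
      then show "countable {t. x(i := t) \<in> {y \<in> space (cube_measure m). y i = y j}}"
        by (rule countable_subset) auto
    qed (use that in auto)
  qed auto
  then have "AE y in cube_measure m. \<forall>i\<in>{1..m}. \<forall>j\<in>{1..m}. i \<noteq> j \<longrightarrow> y i \<noteq> y j"
    by (simp add: AE_ball_countable)
  then show ?thesis by (rule AE_mp) (auto simp: inj_on_def)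
qed

lemma emeasure_UN_order_cells:
  assumes P: "P \<subseteq> {p. p permutes {1..m}}"
  shows "emeasure (cube_measure m) (\<Union>p\<in>P. order_cell m p) =
    of_nat (card P) * emeasure (cube_measure m) (order_cell m id)"
proof -
  have fin: "finite P" using P finite_permutations[of "{1..m}"] finite_subset by auto
  have "emeasure (cube_measure m) (\<Union>p\<in>P. order_cell m p) =
      (\<Sum>p\<in>P. emeasure (cube_measure m) (order_cell m p))"
  proof (rule sum_emeasure[symmetric])
    show "disjoint_family_on (order_cell m) P"
      unfolding disjoint_family_on_def using P order_cell_disjoint by blast
  qed (use fin in auto)
  also have "\<dots> = (\<Sum>p\<in>P. emeasure (cube_measure m) (order_cell m id))"
    using P by (intro sum.cong emeasure_order_cell_eq_id) auto
  finally show ?thesis by simp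
qed

text \<open>The m! cells are disjoint, equally large, and cover the cube of volume 1 up to the null
  set of ties.\<close>

lemma emeasure_order_cell: "emeasure (cube_measure m) (order_cell m id) = ennreal (1 / fact m)"
proof -
  have AE: "AE y in cube_measure m. y \<in> unit_cube m \<longleftrightarrow> y \<in> (\<Union>p\<in>{p. p permutes {1..m}}. order_cell m p)"
    using AE_inj_on
  proof eventually_elim
    case (elim y)
    then show ?case using order_cell_exists[of y m] unfolding order_cell_def by blast
  qed
  have "1 = emeasure (cube_measure m) (unit_cube m)" by (simp add: emeasure_unit_cube)
  also have "\<dots> = emeasure (cube_measure m) (\<Union>p\<in>{p. p permutes {1..m}}. order_cell m p)"
    using AE by (rule emeasure_eq_AE) (auto intro!: sets.finite_UN simp: finite_permutations)
  also have "\<dots> = of_nat (fact m) * emeasure (cube_measure m) (order_cell m id)"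
    using card_permutations[of "{1..m}" m] by (simp add: emeasure_UN_order_cells)
  finally have eq: "of_nat (fact m) * emeasure (cube_measure m) (order_cell m id) = 1" by simp
  then have "emeasure (cube_measure m) (order_cell m id) \<noteq> \<infinity>"
    by (auto simp: ennreal_mult_top)
  then obtain r where r: "emeasure (cube_measure m) (order_cell m id) = ennreal r" "r \<ge> 0"
    by (metis ennreal_cases infinity_ennreal_def)
  have "ennreal (fact m * r) = ennreal 1"
    using eq r by (simp add: ennreal_mult' ennreal_of_nat_eq_real_of_nat)
  then have "fact m * r = 1" using r by (subst (asm) ennreal_inj) auto
  then show ?thesis using r by (simp add: field_simps)
qed

text \<open>Turns volume into counting: up to ties, the part of \<open>E\<close> in the cube is a
  union of whole cells.\<close>

lemma measure_order_invariant:
  assumes E: "E \<in> sets (cube_measure m)"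
    and cells: "\<And>p y. p permutes {1..m} \<Longrightarrow> y \<in> order_cell m p \<Longrightarrow> y \<in> E \<longleftrightarrow> Q p"
  shows "measure (cube_measure m) (unit_cube m \<inter> E) = card {p. p permutes {1..m} \<and> Q p} / fact m"
proof -
  let ?P = "{p. p permutes {1..m} \<and> Q p}"
  have AE: "AE y in cube_measure m. y \<in> unit_cube m \<inter> E \<longleftrightarrow> y \<in> (\<Union>p\<in>?P. order_cell m p)"
    using AE_inj_on
  proof eventually_elim
    case (elim y)
    then show ?case using order_cell_exists[of y m] cells unfolding order_cell_def by blast
  qed
  have "finite ?P" by (rule finite_subset[OF _ finite_permutations[of "{1..m}"]]) auto
  then have "emeasure (cube_measure m) (unit_cube m \<inter> E) = emeasure (cube_measure m) (\<Union>p\<in>?P. order_cell m p)"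
    using AE E by (intro emeasure_eq_AE) (auto intro!: sets.finite_UN)
  also have "\<dots> = ennreal (real (card ?P) * (1 / fact m))"
    by (subst emeasure_UN_order_cells)
      (auto simp: emeasure_order_cell ennreal_of_nat_eq_real_of_nat simp flip: ennreal_mult')
  finally show ?thesis by (simp add: measure_def)
qed

subsection \<open>Descents and the cycle lemma\<close>

text \<open>Polymorphic because it is applied to permutations and to real vectors alike. Position 0
  is left out: a permutation of \<open>{1..m}\<close> has the value 0 there and cannot descend,
  while an extensional vector is \<open>undefined\<close> there.\<close>

definition ndesc :: "(nat \<Rightarrow> 'a::ord) \<Rightarrow> nat \<Rightarrow> nat" where
  "ndesc f k = card {i \<in> {1..<k}. f (Suc i) < f i}"

lemma ndesc_0 [simp]: "ndesc f 0 = 0"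
  by (simp add: ndesc_def)

lemma ndesc_Suc: "ndesc f (Suc k) = ndesc f k + (if k \<ge> 1 \<and> f (Suc k) < f k then 1 else 0)"
proof -
  have "{i \<in> {1..<Suc k}. f (Suc i) < f i} =
      {i \<in> {1..<k}. f (Suc i) < f i} \<union> (if k \<ge> 1 \<and> f (Suc k) < f k then {k} else {})"
    by (auto simp: less_Suc_eq)
  then show ?thesis by (simp add: ndesc_def)
qed

lemma card_descents: "card (descents m p) = ndesc p m"
  by (simp add: descents_def ndesc_def Suc_eq_plus1)

text \<open>Lifts to \<open>\<int>\<close> of the walks around \<open>\<int>/N\<int>\<close> that start at 0, visit every residue once and wind
  \<open>K\<close> times; the winding number up to time \<open>k\<close> counts the descents of the residues before \<open>k\<close>.\<close>

definition cyclic_lifts :: "int \<Rightarrow> int \<Rightarrow> (int \<Rightarrow> int) set" where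
  "cyclic_lifts N K = {t. t 0 = 0 \<and> (\<forall>k. t k < t (k + 1) \<and> t (k + 1) < t k + N) \<and>
     (\<forall>k. t (k + N) = t k + K * N) \<and> (\<forall>i j. t i mod N = t j mod N \<longrightarrow> i mod N = j mod N)}"

lemma cyclic_liftsI:
  assumes "t 0 = 0" "\<And>k. t k < t (k + 1)" "\<And>k. t (k + 1) < t k + N"
    "\<And>k. t (k + N) = t k + K * N" "\<And>i j. t i mod N = t j mod N \<Longrightarrow> i mod N = j mod N"
  shows "t \<in> cyclic_lifts N K"
  unfolding cyclic_lifts_def mem_Collect_eq by (intro conjI allI impI; rule assms)

lemma cyclic_liftsD:
  assumes "t \<in> cyclic_lifts N K"
  shows "t 0 = 0" "t k < t (k + 1)" "t (k + 1) < t k + N" "t (k + N) = t k + K * N"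
    "t i mod N = t j mod N \<Longrightarrow> i mod N = j mod N"
proof -
  note unfolded = assms[unfolded cyclic_lifts_def mem_Collect_eq]
  note t = unfolded[THEN conjunct1] unfolded[THEN conjunct2, THEN conjunct1]
    unfolded[THEN conjunct2, THEN conjunct2, THEN conjunct1]
    unfolded[THEN conjunct2, THEN conjunct2, THEN conjunct2]
  show "t 0 = 0" by (rule t(1))
  show "t k < t (k + 1)" by (rule t(2)[rule_format, THEN conjunct1])
  show "t (k + 1) < t k + N" by (rule t(2)[rule_format, THEN conjunct2])
  show "t (k + N) = t k + K * N" by (rule t(3)[rule_format])
  show "t i mod N = t j mod N \<Longrightarrow> i mod N = j mod N" by (rule t(4)[rule_format])
qed

section \<open>Rotations of lifts and the cycle lemma\<close>

text \<open>On residues this rotates the cyclic word to start at position \<open>e\<close> and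
  subtracts its new first entry modulo N. On lifts it is a translation of argument and
  value.\<close>

definition shift :: "int \<Rightarrow> (int \<Rightarrow> int) \<Rightarrow> int \<Rightarrow> int" where
  "shift e t = (\<lambda>k. t (k + e) - t e)"

lemma shift_in_cyclic_lifts:
  assumes "t \<in> cyclic_lifts N K"
  shows "shift e t \<in> cyclic_lifts N K"
proof (rule cyclic_liftsI)
  show "i mod N = j mod N" if "shift e t i mod N = shift e t j mod N" for i j
  proof -
    have "(t (i + e) - t e) mod N = (t (j + e) - t e) mod N" using that by (simp add: shift_def)
    from mod_add_cong[OF this refl, of "t e"] have "t (i + e) mod N = t (j + e) mod N" by simp
    then have "(i + e) mod N = (j + e) mod N" by (rule cyclic_liftsD(5)[OF assms])
    from mod_diff_cong[OF this refl, of e] show ?thesis by simp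
  qed
  show "shift e t k < shift e t (k + 1)" "shift e t (k + 1) < shift e t k + N"
      "shift e t (k + N) = shift e t k + K * N" for k
    using cyclic_liftsD(2-4)[OF assms, of "k + e"] by (simp_all add: shift_def ac_simps)
qed (simp add: shift_def)

lemma shift_shift:
  assumes "t 0 = 0"
  shows "shift (- e) (shift e t) = t" "shift e (shift (- e) t) = t"
  using assms by (auto simp: shift_def)

text \<open>Since lifts start at 0, the shifts by \<open>e\<close> and \<open>- e\<close> undo each
  other on them.\<close>

lemma card_shift_vimage:
  assumes "G \<subseteq> cyclic_lifts N K"
  shows "card {t \<in> cyclic_lifts N K. shift e t \<in> G} = card G"
proof (rule bij_betw_same_card[of "shift e"], rule bij_betw_byWitness[where f' = "shift (- e)"])
  show "shift (- e) ` G \<subseteq> {t \<in> cyclic_lifts N K. shift e t \<in> G}"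
  proof
    fix t assume "t \<in> shift (- e) ` G"
    then obtain s where s: "s \<in> G" "t = shift (- e) s" by auto
    then have "s \<in> cyclic_lifts N K" using assms by auto
    then show "t \<in> {t \<in> cyclic_lifts N K. shift e t \<in> G}"
      using s shift_in_cyclic_lifts[of s] cyclic_liftsD(1)[of s] by (simp add: shift_shift)
  qed
  show "shift e ` {t \<in> cyclic_lifts N K. shift e t \<in> G} \<subseteq> G" by blast
  show "\<forall>t\<in>{t \<in> cyclic_lifts N K. shift e t \<in> G}. shift (- e) (shift e t) = t"
    by (intro ballI shift_shift(1)) (auto intro: cyclic_liftsD(1))
  show "\<forall>t\<in>G. shift e (shift (- e) t) = t"
    using assms by (intro ballI shift_shift(2)) (auto intro: cyclic_liftsD(1))
qed

text \<open>The ballot condition at the block ends, scaled by the period \<open>n * d\<close>;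
  \<open>card_ballot_permutations\<close> shows that it amounts to a condition on descent
  counts.\<close>

definition good_lifts :: "int \<Rightarrow> int \<Rightarrow> int \<Rightarrow> (int \<Rightarrow> int) set" where
  "good_lifts n d b =
    {t \<in> cyclic_lifts (n * d) (n * b). \<forall>j\<in>{0..<n}. j * b * (n * d) \<le> t (j * d)}"

text \<open>Subtracting the average rise per block makes the heights \<open>u\<close> at the block
  ends periodic. The rotation that starts at block \<open>e\<close> is good iff no height lies below
  \<open>u e\<close>, so the good rotations are the minima of \<open>u\<close> over one
  period.\<close>

lemma cycle_lemma:
  fixes n d b :: int
  assumes n: "n > 0" and d: "d > 0" and t: "t \<in> cyclic_lifts (n * d) (n * b)"
  shows "card {e \<in> {0..<n}. shift (e * d) t \<in> good_lifts n d b} = 1"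
proof -
  define u where "u j = t (j * d) - j * b * (n * d)" for j
  have periodic: "u (j + n) = u j" for j
  proof -
    have "t (j * d + n * d) = t (j * d) + n * b * (n * d)" by (rule cyclic_liftsD(4)[OF t])
    then show ?thesis by (simp add: u_def algebra_simps)
  qed
  \<comment> \<open>A tie would make \<open>t\<close> agree modulo \<open>n * d\<close> at two block
    ends of one period, which lifts forbid; so the minimum is attained only once.\<close>
  have inj: "i = j" if "i \<in> {0..<n}" "j \<in> {0..<n}" "u i = u j" for i j
  proof -
    have "t (i * d) = t (j * d) + (i - j) * b * (n * d)"
      using that(3) by (simp add: u_def algebra_simps)
    then have "t (i * d) mod (n * d) = t (j * d) mod (n * d)" by simp
    then have "(i * d) mod (n * d) = (j * d) mod (n * d)" by (rule cyclic_liftsD(5)[OF t])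
    then show ?thesis using that d by (simp add: mod_mult_mult2)
  qed
  have good: "shift (e * d) t \<in> good_lifts n d b \<longleftrightarrow> (\<forall>j\<in>{0..<n}. u e \<le> u j)" if e: "e \<in> {0..<n}" for e
  proof -
    have "shift (e * d) t \<in> good_lifts n d b \<longleftrightarrow> (\<forall>j\<in>{0..<n}. u e \<le> u (e + j))"
      using shift_in_cyclic_lifts[OF t, of "e * d"]
      by (simp add: good_lifts_def) (simp add: shift_def u_def algebra_simps)
    also have "\<dots> \<longleftrightarrow> (\<forall>j\<in>{0..<n}. u e \<le> u j)"
    proof (intro iffI ballI)
      fix j assume *: "\<forall>j\<in>{0..<n}. u e \<le> u (e + j)" and j: "j \<in> {0..<n}"
      show "u e \<le> u j"
      proof (cases "e \<le> j")
        case True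
        then show ?thesis using *[rule_format, of "j - e"] e j by simp
      next
        case False
        then show ?thesis using *[rule_format, of "j + n - e"] e j periodic[of j] by simp
      qed
    next
      fix j assume *: "\<forall>j\<in>{0..<n}. u e \<le> u j" and j: "j \<in> {0..<n}"
      show "u e \<le> u (e + j)"
      proof (cases "e + j < n")
        case True
        then show ?thesis using *[rule_format, of "e + j"] e j by simp
      next
        case False
        then show ?thesis using *[rule_format, of "e + j - n"] e j periodic[of "e + j - n"] by simp
      qed
    qed
    finally show ?thesis .
  qed
  have "{0..<n} \<noteq> {}" using n by auto
  then have "Min (u ` {0..<n}) \<in> u ` {0..<n}" by (intro Min_in) auto
  then obtain e where "e \<in> {0..<n}" "u e = Min (u ` {0..<n})" by auto
  then have e: "e \<in> {0..<n}" "\<forall>j\<in>{0..<n}. u e \<le> u j" by auto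
  have "{e \<in> {0..<n}. shift (e * d) t \<in> good_lifts n d b} = {e}"
  proof (intro set_eqI iffI)
    fix f assume "f \<in> {e \<in> {0..<n}. shift (e * d) t \<in> good_lifts n d b}"
    then have f: "f \<in> {0..<n}" "\<forall>j\<in>{0..<n}. u f \<le> u j" using good by auto
    then have "u e = u f" using e by (meson order_antisym)
    then show "f \<in> {e}" using inj[OF e(1) f(1)] by simp
  qed (use e good in auto)
  then show ?thesis by simp
qed

lemma card_filter_eq_sum:
  "finite A \<Longrightarrow> card {x \<in> A. P x} = (\<Sum>x\<in>A. if P x then 1 else 0)"
  by (simp only: card_eq_sum sum.inter_filter)

text \<open>Double counting of the pairs of a lift \<open>t\<close> and a rotation \<open>e\<close>
  that makes it good: each \<open>t\<close> has exactly one such \<open>e\<close>, and each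
  \<open>e\<close> has as many such \<open>t\<close> as there are good lifts.\<close>

lemma card_cyclic_lifts:
  fixes n :: nat and d b :: int
  assumes n: "n > 0" and d: "d > 0" and fin: "finite (cyclic_lifts (int n * d) (int n * b))"
  shows "card (cyclic_lifts (int n * d) (int n * b)) = n * card (good_lifts (int n) d b)"
proof -
  let ?X = "cyclic_lifts (int n * d) (int n * b)" and ?G = "good_lifts (int n) d b"
  have "card ?X = (\<Sum>t\<in>?X. card {e \<in> {0..<int n}. shift (e * d) t \<in> ?G})"
    using cycle_lemma[of "int n" d _ b] n d by (simp del: atLeastLessThan_iff)
  also have "\<dots> = (\<Sum>t\<in>?X. \<Sum>e\<in>{0..<int n}. if shift (e * d) t \<in> ?G then 1 else 0)"
    by (simp only: card_filter_eq_sum finite_atLeastLessThan_int)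
  also have "\<dots> = (\<Sum>e\<in>{0..<int n}. \<Sum>t\<in>?X. if shift (e * d) t \<in> ?G then 1 else 0)"
    by (rule sum.swap)
  also have "\<dots> = (\<Sum>e\<in>{0..<int n}. card {t \<in> ?X. shift (e * d) t \<in> ?G})"
    using fin by (simp only: card_filter_eq_sum)
  also have "\<dots> = (\<Sum>e\<in>{0..<int n}. card ?G)"
    by (intro sum.cong refl card_shift_vimage) (auto simp: good_lifts_def)
  finally show ?thesis by simp
qed

section \<open>Permutations correspond to cyclic lifts\<close>

text \<open>The word \<open>0, p 1, ..., p m\<close> repeated with period N = m + 1. The factor of N
  counts the wraps so far: one per descent within the current period and \<open>K\<close> for each
  full period. The leading 0 is \<open>p 0\<close>, which a permutation of \<open>{1..m}\<close>
  fixes.\<close>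

definition lift_perm :: "nat \<Rightarrow> nat \<Rightarrow> (nat \<Rightarrow> nat) \<Rightarrow> int \<Rightarrow> int" where
  "lift_perm m K p k =
    (int m + 1) * (int (ndesc p (nat (k mod (int m + 1)))) + int K * (k div (int m + 1))) +
    int (p (nat (k mod (int m + 1))))"

lemma lift_perm_of_nat:
  "k \<le> m \<Longrightarrow> lift_perm m K p (int k) = (int m + 1) * int (ndesc p k) + int (p k)"
  by (simp add: lift_perm_def)

lemma permutes_le:
  assumes "p permutes {1..m}" "k \<le> (m::nat)"
  shows "p k \<le> m"
  using assms permutes_in_image[OF assms(1), of k] permutes_not_in[OF assms(1), of k]
  by (cases "k \<in> {1..m}") auto

lemma lift_perm_mod:
  assumes "p permutes {1..m}"
  shows "lift_perm m K p k mod (int m + 1) = int (p (nat (k mod (int m + 1))))"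
proof -
  have "k mod (int m + 1) < int m + 1" by (rule pos_mod_bound) simp
  then have "p (nat (k mod (int m + 1))) \<le> m" by (intro permutes_le[OF assms]) linarith
  then show ?thesis by (simp add: lift_perm_def)
qed

text \<open>An ascent raises the lift by the difference of the entries, a descent by that difference
  plus N, and the return to 0 by N minus the last entry. All three lie strictly between 0 and N
  because the entries are distinct and at most \<open>m\<close>.\<close>

lemma lift_perm_in_cyclic_lifts:
  assumes p: "p permutes {1..m}" and m: "m > 0" and K: "ndesc p m + 1 = K"
  shows "lift_perm m K p \<in> cyclic_lifts (int m + 1) (int K)"
proof -
  let ?N = "int m + 1" and ?t = "lift_perm m K p"
  have p0: "p 0 = 0" using permutes_not_in[OF p, of 0] by simp
  have inj: "p i = p j \<Longrightarrow> i = j" for i j using permutes_inj[OF p] by (auto dest: injD)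
  have step: "?t k < ?t (k + 1) \<and> ?t (k + 1) < ?t k + ?N" for k
  proof -
    define r where "r = nat (k mod ?N)"
    have r: "k mod ?N = int r" by (simp add: r_def)
    have "k mod ?N < ?N" by (rule pos_mod_bound) simp
    then have "r \<le> m" using r by linarith
    have t: "?t k = ?N * (int (ndesc p r) + int K * (k div ?N)) + int (p r)"
      by (simp add: lift_perm_def r)
    have k: "k = ?N * (k div ?N) + int r" using r by (metis mult_div_mod_eq)
    show ?thesis
    proof (cases "r < m")
      case True
      have "k + 1 = ?N * (k div ?N) + (int r + 1)" using k by linarith
      then have "(k + 1) div ?N = k div ?N \<and> (k + 1) mod ?N = int r + 1"
        using True int_div_pos_eq[of "k + 1" ?N "k div ?N" "int r + 1"]
          int_mod_pos_eq[of "k + 1" ?N "k div ?N" "int r + 1"] by simp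
      then have t': "?t (k + 1) = ?N * (int (ndesc p (Suc r)) + int K * (k div ?N)) + int (p (Suc r))"
        by (simp add: lift_perm_def nat_add_distrib nat_one_as_int)
      have "p r \<le> m" "p (Suc r) \<le> m" using True by (auto intro: permutes_le[OF p])
      moreover have "p r \<noteq> p (Suc r)" using inj[of r "Suc r"] by auto
      \<comment> \<open>No descent can start at the entry 0, so the exclusion of position 0 in
        \<open>ndesc\<close> loses no wrap.\<close>
      moreover have "p (Suc r) < p r \<Longrightarrow> r \<ge> 1" using p0 by (cases r) auto
      ultimately show ?thesis unfolding t t' ndesc_Suc
        by (cases "p (Suc r) < p r") (auto simp: algebra_simps)
    next
      case False
      then have "r = m" using \<open>r \<le> m\<close> by simp
      then have "k + 1 = ?N * (k div ?N + 1)" using k by (simp add: algebra_simps)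
      then have "(k + 1) div ?N = k div ?N + 1 \<and> (k + 1) mod ?N = 0"
        by simp
      then have t': "?t (k + 1) = ?N * (int K * (k div ?N + 1))"
        by (simp add: lift_perm_def p0)
      have "p m \<le> m" by (auto intro: permutes_le[OF p])
      moreover have "p m \<noteq> 0" using inj[of m 0] p0 m by auto
      ultimately show ?thesis unfolding t t' \<open>r = m\<close> using K by (auto simp: algebra_simps)
    qed
  qed
  have period: "?t (k + ?N) = ?t k + int K * ?N" for k
  proof -
    have "(k + ?N) mod ?N = k mod ?N" "(k + ?N) div ?N = k div ?N + 1"
      using div_mult_self1[of ?N k 1] by simp_all
    then show ?thesis unfolding lift_perm_def by (simp only: algebra_simps)
  qed
  have inj_mod: "i mod ?N = j mod ?N" if "?t i mod ?N = ?t j mod ?N" for i j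
  proof -
    have "nat (i mod ?N) = nat (j mod ?N)"
      using that inj unfolding lift_perm_mod[OF p] by simp
    then show ?thesis by (simp add: eq_nat_nat_iff)
  qed
  have "?t 0 = 0" by (simp add: lift_perm_def p0)
  then show ?thesis using conjunct1[OF step] conjunct2[OF step] period inj_mod by (rule cyclic_liftsI)
qed

text \<open>The permutation consists of the residues of \<open>t\<close> over one period. Increments
  lie strictly between 0 and N, so consecutive residues determine them, and a multiple of N is
  crossed exactly at a descent.\<close>

lemma cyclic_lift_is_lift_perm:
  assumes t: "t \<in> cyclic_lifts (int m + 1) (int K)" and m: "m > 0"
  obtains p where "p permutes {1..m}" "ndesc p m + 1 = K" "t = lift_perm m K p"
proof -
  let ?N = "int m + 1"
  have t0: "t 0 = 0" and step: "\<And>k. t k < t (k + 1)" "\<And>k. t (k + 1) < t k + ?N"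
    and period: "\<And>k. t (k + ?N) = t k + int K * ?N"
    and inj: "\<And>i j. t i mod ?N = t j mod ?N \<Longrightarrow> i mod ?N = j mod ?N"
    using cyclic_liftsD[OF t] by blast+
  define p where "p k = (if k \<in> {1..m} then nat (t (int k) mod ?N) else k)" for k
  have p_mod: "int (p k) = t (int k) mod ?N" if "k \<le> m" for k
    using that by (cases "k = 0") (simp_all add: p_def t0)
  have p_le: "p k \<le> m" if "k \<le> m" for k
    using p_mod[OF that] pos_mod_bound[of ?N "t (int k)"] by linarith
  have p_inj: "i = j" if "p i = p j" "i \<le> m" "j \<le> m" for i j
  proof -
    have "t (int i) mod ?N = t (int j) mod ?N"
      by (simp only: that p_mod[OF that(2), symmetric] p_mod[OF that(3), symmetric])
    then have "int i mod ?N = int j mod ?N" by (rule inj)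
    then show ?thesis using that by simp
  qed
  have "inj_on p {1..m}" using p_inj by (auto intro: inj_onI)
  moreover have "p ` {1..m} \<subseteq> {1..m}"
  proof
    fix k assume "k \<in> p ` {1..m}"
    then obtain i where i: "i \<in> {1..m}" "k = p i" by auto
    have "p 0 = 0" by (simp add: p_def)
    then have "p i \<noteq> 0" using p_inj[of i 0] i by auto
    then show "k \<in> {1..m}" using p_le[of i] i by auto
  qed
  ultimately have "bij_betw p {1..m} {1..m}" by (simp add: bij_betw_def endo_inj_surj)
  then have perm: "p permutes {1..m}" by (rule bij_imp_permutes) (auto simp: p_def)
  have t_eq: "t (int k) = ?N * int (ndesc p k) + int (p k)" if "k \<le> m" for k
    using that
  proof (induction k)
    case 0
    then show ?case by (simp add: t0 p_def)
  next
    case (Suc k)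
    define \<delta> where "\<delta> = t (int (Suc k)) - t (int k)"
    have \<delta>: "0 < \<delta>" "\<delta> < ?N" using step[of "int k"] by (auto simp: \<delta>_def add.commute)
    have t_Suc: "t (int (Suc k)) = ?N * int (ndesc p k) + (int (p k) + \<delta>)"
      using Suc by (simp add: \<delta>_def)
    have le: "p k \<le> m" using Suc.prems p_le by simp
    have p_Suc: "int (p (Suc k)) = (int (p k) + \<delta>) mod ?N"
      using p_mod[OF Suc.prems] unfolding t_Suc by simp
    \<comment> \<open>The sum is below 2N, so reduction subtracts 0 or N. Subtracting N yields a
      descent because \<delta> is less than N.\<close>
    show ?case
    proof (cases "int (p k) + \<delta> < ?N")
      case True
      then have "int (p (Suc k)) = int (p k) + \<delta>" using p_Suc \<delta> by simp
      then show ?thesis using t_Suc \<delta> by (simp add: ndesc_Suc)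
    next
      case False
      have "(int (p k) + \<delta>) mod ?N = (int (p k) + \<delta> - ?N) mod ?N" by simp
      also have "\<dots> = int (p k) + \<delta> - ?N" using False \<delta> le by (intro mod_pos_pos_trivial) auto
      finally have p_eq: "int (p (Suc k)) = int (p k) + \<delta> - ?N" using p_Suc by simp
      have "p 0 = 0" by (simp add: p_def)
      then have "k \<noteq> 0" using False \<delta> by (cases "k = 0") simp_all
      then show ?thesis using t_Suc \<delta> p_eq by (simp add: ndesc_Suc algebra_simps)
    qed
  qed
  \<comment> \<open>The value at time m + 1 is K * N. It exceeds the value at time m, which is N
    times the descent number plus a residue, by less than N; this leaves only one possible
    K.\<close>
  have K: "ndesc p m + 1 = K"
  proof -
    have "t (int m + 1) = int K * ?N" using period[of 0] by (simp add: t0)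
    then have "?N * int (ndesc p m) < int K * ?N" "int K * ?N < ?N * (int (ndesc p m) + 2)"
      using step[of "int m"] t_eq[of m] p_le[of m] by (auto simp: algebra_simps)
    then have "int (ndesc p m) < int K" "int K < int (ndesc p m) + 2"
      by (simp_all add: mult.commute[of "int K"])
    then show ?thesis by linarith
  qed
  have "t k = lift_perm m K p k" for k
  proof -
    have shift: "t (r + ?N * q) = t r + int K * ?N * q" for r q
    proof (induction q rule: int_induct[where k = 0])
      case (step1 i)
      then show ?case using period[of "r + ?N * i"] by (simp add: algebra_simps)
    next
      case (step2 i)
      then show ?case using period[of "r + ?N * (i - 1)"] by (simp add: algebra_simps)
    qed simp
    define r where "r = nat (k mod ?N)"
    have r: "k mod ?N = int r" by (simp add: r_def)
    have "k mod ?N < ?N" by (rule pos_mod_bound) simp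
    then have "r \<le> m" using r by linarith
    have "t k = t (int r + ?N * (k div ?N))" by (simp flip: r)
    also have "\<dots> = lift_perm m K p k"
      unfolding shift t_eq[OF \<open>r \<le> m\<close>] lift_perm_def r nat_int by (simp only: algebra_simps)
    finally show ?thesis .
  qed
  then show thesis using that perm K by blast
qed

lemma bij_betw_lift_perm:
  assumes m: "m > 0"
  shows "bij_betw (lift_perm m K) {p. p permutes {1..m} \<and> ndesc p m + 1 = K}
    (cyclic_lifts (int m + 1) (int K))"
proof (rule bij_betwI')
  fix p q assume p: "p \<in> {p. p permutes {1..m} \<and> ndesc p m + 1 = K}"
    and q: "q \<in> {p. p permutes {1..m} \<and> ndesc p m + 1 = K}"
  have "p = q" if eq: "lift_perm m K p = lift_perm m K q"
  proof
    fix k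
    show "p k = q k"
    proof (cases "k \<le> m")
      case True
      then show ?thesis
        using lift_perm_mod[of p m K "int k"] lift_perm_mod[of q m K "int k"] p q eq by simp
    next
      case False
      then show ?thesis using p q permutes_not_in[of p "{1..m}" k] permutes_not_in[of q "{1..m}" k] by simp
    qed
  qed
  then show "lift_perm m K p = lift_perm m K q \<longleftrightarrow> p = q" by blast
next
  fix p assume "p \<in> {p. p permutes {1..m} \<and> ndesc p m + 1 = K}"
  then show "lift_perm m K p \<in> cyclic_lifts (int m + 1) (int K)"
    using lift_perm_in_cyclic_lifts m by blast
next
  fix t assume "t \<in> cyclic_lifts (int m + 1) (int K)"
  then show "\<exists>p\<in>{p. p permutes {1..m} \<and> ndesc p m + 1 = K}. t = lift_perm m K p"
    using cyclic_lift_is_lift_perm[OF _ m] by blast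
qed

text \<open>At a block end the lift is N times the descent count plus an entry in [0, N), so it
  reaches \<open>j * b * N\<close> exactly when the count reaches \<open>j * b\<close>. Good lifts
  are therefore the ballot permutations, and all lifts of winding number \<open>n * b\<close> are
  the permutations counted by \<open>eulerian\<close>.\<close>

lemma card_ballot_permutations:
  fixes n d b m :: nat
  assumes m: "m > 0" and N: "n * d = m + 1"
  shows "n * card {p. p permutes {1..m} \<and> ndesc p m + 1 = n * b \<and> (\<forall>j<n. j * b \<le> ndesc p (j * d))} =
    eulerian m (n * b)"
proof -
  let ?P = "{p. p permutes {1..m} \<and> ndesc p m + 1 = n * b}"
  let ?Q = "{p. p permutes {1..m} \<and> ndesc p m + 1 = n * b \<and> (\<forall>j<n. j * b \<le> ndesc p (j * d))}"
  have nd: "n > 0" "d > 0" using N by (auto intro: Nat.gr0I)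
  have N': "int n * int d = int m + 1" using N by (metis of_nat_1 of_nat_add of_nat_mult)
  have bij: "bij_betw (lift_perm m (n * b)) ?P (cyclic_lifts (int n * int d) (int n * int b))"
    using bij_betw_lift_perm[OF m, of "n * b"] by (simp add: N')
  have good: "lift_perm m (n * b) p \<in> good_lifts n d b \<longleftrightarrow> (\<forall>j<n. j * b \<le> ndesc p (j * d))"
    if p: "p \<in> ?P" for p
  proof -
    have *: "int j * int b * (int n * int d) \<le> lift_perm m (n * b) p (int j * int d) \<longleftrightarrow>
        j * b \<le> ndesc p (j * d)" if "j < n" for j
    proof -
      have "j * d < n * d" using that nd by simp
      then have le: "j * d \<le> m" using N by linarith
      have "p permutes {1..m}" using p by blast
      from permutes_le[OF this le] have le': "p (j * d) \<le> m" .
      have "lift_perm m (n * b) p (int (j * d)) = (int m + 1) * int (ndesc p (j * d)) + int (p (j * d))"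
        by (rule lift_perm_of_nat[OF le])
      moreover have "int (j * b) * (int m + 1) \<le> (int m + 1) * int (ndesc p (j * d)) + int (p (j * d))
          \<longleftrightarrow> int (j * b) \<le> int (ndesc p (j * d))"
      proof
        assume "int (j * b) * (int m + 1) \<le> (int m + 1) * int (ndesc p (j * d)) + int (p (j * d))"
        also have "\<dots> < (int m + 1) * (int (ndesc p (j * d)) + 1)" using le' by (simp add: algebra_simps)
        finally have "int (j * b) < int (ndesc p (j * d)) + 1" by (simp add: mult.commute[of "int (j * b)"])
        then show "int (j * b) \<le> int (ndesc p (j * d))" by simp
      next
        assume "int (j * b) \<le> int (ndesc p (j * d))"
        then have "(int m + 1) * int (j * b) \<le> (int m + 1) * int (ndesc p (j * d))" by (intro mult_left_mono) auto
        then show "int (j * b) * (int m + 1) \<le> (int m + 1) * int (ndesc p (j * d)) + int (p (j * d))"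
          by (subst mult.commute) linarith
      qed
      ultimately show ?thesis by (simp only: N' of_nat_le_iff of_nat_mult [symmetric, of j])
    qed
    have ball: "(\<forall>j\<in>{0..<int n}. R j) \<longleftrightarrow> (\<forall>j<n. R (int j))" for R
    proof -
      have "{0..<int n} = int ` {..<n}"
        by (simp add: lessThan_atLeast0 image_int_atLeastLessThan)
      then show ?thesis by auto
    qed
    have mem: "lift_perm m (n * b) p \<in> cyclic_lifts (int n * int d) (int n * int b)"
      by (rule bij_betw_apply[OF bij p])
    show ?thesis unfolding good_lifts_def by (simp only: mem_Collect_eq mem ball * simp_thms cong: imp_cong)
  qed
  have "bij_betw (lift_perm m (n * b)) ?Q (good_lifts n d b)"
  proof (rule bij_betw_subset[OF bij, of ?Q])
    show "lift_perm m (n * b) ` ?Q = good_lifts n d b"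
    proof
      show "lift_perm m (n * b) ` ?Q \<subseteq> good_lifts n d b"
      proof
        fix t assume "t \<in> lift_perm m (n * b) ` ?Q"
        then obtain p where p: "p \<in> ?Q" "t = lift_perm m (n * b) p" by (rule imageE)
        then have "p \<in> ?P" by blast
        from good[OF this] p show "t \<in> good_lifts n d b" by blast
      qed
      show "good_lifts n d b \<subseteq> lift_perm m (n * b) ` ?Q"
      proof
        fix t assume t: "t \<in> good_lifts n d b"
        then have "t \<in> lift_perm m (n * b) ` ?P"
          using bij unfolding bij_betw_def good_lifts_def by blast
        then show "t \<in> lift_perm m (n * b) ` ?Q" using good t by blast
      qed
    qed
  qed blast
  then have "card ?Q = card (good_lifts n d b)" by (rule bij_betw_same_card)
  moreover have "card ?P = card (cyclic_lifts (int n * int d) (int n * int b))"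
    using bij by (rule bij_betw_same_card)
  moreover have "finite ?P" by (rule finite_subset[OF _ finite_permutations[of "{1..m}"]]) auto
  then have "finite (cyclic_lifts (int n * int d) (int n * int b))"
    using bij bij_betw_finite by blast
  ultimately have "n * card ?Q = card ?P" using card_cyclic_lifts[of n "int d" "int b"] nd by simp
  then show ?thesis by (simp add: eulerian_def card_descents)
qed

subsection \<open>The matroid polytope of the Catalan matroid\<close>

text \<open>The indices whose entry is at most \<open>k\<close> form an initial segment, and there
  are as many of them as elements of \<open>A\<close> up to \<open>k\<close>.\<close>

lemma sorted_list_of_set_nth_le_iff:
  fixes A :: "nat set"
  assumes A: "finite A" and i: "i < card A"
  shows "sorted_list_of_set A ! i \<le> k \<longleftrightarrow> i < card (A \<inter> {..k})"
proof -
  let ?xs = "sorted_list_of_set A"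
  let ?J = "{j \<in> {..<card A}. ?xs ! j \<le> k}"
  have len: "length ?xs = card A" by simp
  have "A \<inter> {..k} = (\<lambda>j. ?xs ! j) ` ?J"
  proof -
    have "A = (\<lambda>j. ?xs ! j) ` {..<card A}"
      using A nth_image[of "card A" ?xs] by (simp add: lessThan_atLeast0)
    then have "A \<inter> {..k} = (\<lambda>j. ?xs ! j) ` {..<card A} \<inter> {..k}" by simp
    also have "\<dots> = (\<lambda>j. ?xs ! j) ` ?J" by auto
    finally show ?thesis .
  qed
  moreover have "inj_on (\<lambda>j. ?xs ! j) ?J"
    by (rule inj_on_nth) auto
  ultimately have card: "card (A \<inter> {..k}) = card ?J" by (simp only: card_image)
  have mono: "?xs ! p \<le> ?xs ! q" if "p \<le> q" "q < card A" for p q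
    using that by (intro sorted_nth_mono) auto
  show ?thesis
  proof
    assume "?xs ! i \<le> k"
    then have "{..i} \<subseteq> ?J" using i mono[of _ i] by fastforce
    then have "card {..i} \<le> card ?J" by (rule card_mono[rotated]) simp
    then show "i < card (A \<inter> {..k})" unfolding card by simp
  next
    assume less: "i < card (A \<inter> {..k})"
    show "?xs ! i \<le> k"
    proof (rule ccontr)
      assume "\<not> ?xs ! i \<le> k"
      have "?J \<subseteq> {..<i}"
      proof
        fix j assume "j \<in> ?J"
        then show "j \<in> {..<i}" using mono[of i j] \<open>\<not> ?xs ! i \<le> k\<close> by (cases "i \<le> j") simp_all
      qed
      then have "card ?J \<le> card {..<i}" by (rule card_mono[rotated]) simp
      then show False using less unfolding card by simp
    qed
  qed
qed

text \<open>Prefix counts, unlike sorted entries, are linear in the indicator vector, so this form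
  of the basis condition yields inequalities for the polytope.\<close>

lemma sorted_list_of_set_dominated_iff:
  fixes S T :: "nat set"
  assumes S: "finite S" and T: "finite T" and card: "card T = card S"
  shows "(\<forall>i < card S. sorted_list_of_set T ! i \<le> sorted_list_of_set S ! i) \<longleftrightarrow>
    (\<forall>k. card (S \<inter> {..k}) \<le> card (T \<inter> {..k}))"
proof (intro iffI allI impI)
  fix k assume dom: "\<forall>i < card S. sorted_list_of_set T ! i \<le> sorted_list_of_set S ! i"
  show "card (S \<inter> {..k}) \<le> card (T \<inter> {..k})"
  proof (cases "card (S \<inter> {..k})")
    case (Suc i)
    have "card (S \<inter> {..k}) \<le> card S" using S by (intro card_mono) auto
    then have i: "i < card S" using Suc by simp
    then have "sorted_list_of_set S ! i \<le> k"
      using sorted_list_of_set_nth_le_iff[OF S] Suc by simp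
    then have "sorted_list_of_set T ! i \<le> k" using dom i order_trans by blast
    then show ?thesis using sorted_list_of_set_nth_le_iff[OF T] i card Suc by simp
  qed simp
next
  fix i assume le: "\<forall>k. card (S \<inter> {..k}) \<le> card (T \<inter> {..k})" and i: "i < card S"
  let ?k = "sorted_list_of_set S ! i"
  have "i < card (S \<inter> {..?k})" using sorted_list_of_set_nth_le_iff[OF S i, of ?k] by simp
  also have "\<dots> \<le> card (T \<inter> {..?k})" using le by blast
  finally show "sorted_list_of_set T ! i \<le> ?k"
    using sorted_list_of_set_nth_le_iff[OF T, of i ?k] i card by simp
qed

lemma catalan_word_nth:
  "i < n * (a + b) \<Longrightarrow> catalan_word n a b ! i = (if i mod (a + b) < a then 0 else 1)"
proof (induction n arbitrary: i)
  case (Suc n)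
  have word: "catalan_word (Suc n) a b = (replicate a 0 @ replicate b 1) @ catalan_word n a b"
    by (simp add: catalan_word_def)
  show ?case
  proof (cases "i < a + b")
    case True
    then show ?thesis unfolding word by (auto simp: nth_append)
  next
    case False
    then have "(i - (a + b)) mod (a + b) = i mod (a + b)" by (simp add: le_mod_geq)
    moreover have "catalan_word (Suc n) a b ! i = catalan_word n a b ! (i - (a + b))"
      using False unfolding word by (subst nth_append) simp
    ultimately show ?thesis using Suc.IH[of "i - (a + b)"] Suc.prems False by simp
  qed
qed simp

text \<open>The cut-off \<open>k\<close> makes the prefixes of the set that defines the matroid
  instances of the same notion, and \<open>card_catalan_steps\<close> can count them by induction on
  \<open>k\<close>.\<close>

definition catalan_steps :: "nat \<Rightarrow> nat \<Rightarrow> nat \<Rightarrow> nat set" where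
  "catalan_steps a b k = {i \<in> {1..k}. a \<le> (i - 1) mod (a + b)}"

text \<open>A full block contributes \<open>b\<close> ones; a partial block contributes only what
  extends beyond its \<open>a\<close> zeros, hence the truncated subtraction.\<close>

lemma card_catalan_steps:
  assumes "b > 0"
  shows "card (catalan_steps a b k) = (k div (a + b)) * b + (k mod (a + b) - a)"
proof (induction k)
  case 0
  then show ?case by (simp add: catalan_steps_def)
next
  case (Suc k)
  have "catalan_steps a b (Suc k) =
      catalan_steps a b k \<union> (if a \<le> k mod (a + b) then {Suc k} else {})"
    unfolding catalan_steps_def by (auto simp: le_Suc_eq)
  then have "card (catalan_steps a b (Suc k)) =
      card (catalan_steps a b k) + (if a \<le> k mod (a + b) then 1 else 0)"
    by (simp add: catalan_steps_def)
  then show ?case using Suc assms by (auto simp: div_Suc mod_Suc)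
qed

text \<open>Block ends suffice. Inside a block the required count is constant over the zeros, where
  monotonicity from the block start gives it, and then rises by 1 at every step, where it follows
  backwards from the block end because \<open>T\<close> gains at most one element per step.\<close>

lemma bases_catalan_matroid:
  assumes b: "b > 0"
  shows "T \<in> bases (catalan_matroid n a b) \<longleftrightarrow>
    T \<subseteq> {1..n * (a + b)} \<and> card T = n * b \<and> (\<forall>j<n. j * b \<le> card (T \<inter> {..j * (a + b)}))"
proof -
  let ?d = "a + b"
  let ?N = "n * ?d" and ?S = "catalan_steps a b (n * (a + b))"
  have S: "{i \<in> {1..?N}. catalan_word n a b ! (i - 1) = 1} = ?S"
  proof -
    have "catalan_word n a b ! (i - 1) = 1 \<longleftrightarrow> a \<le> (i - 1) mod (a + b)" if "i \<in> {1..?N}" for i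
    proof -
      have "i - 1 < ?N" using that unfolding atLeastAtMost_iff by linarith
      from catalan_word_nth[OF this] show ?thesis by simp
    qed
    then show ?thesis unfolding catalan_steps_def by blast
  qed
  have finS: "finite ?S" by (simp add: catalan_steps_def)
  have S_le: "card (?S \<inter> {..k}) = (k div ?d) * b + (k mod ?d - a)" if "k \<le> ?N" for k
  proof -
    have "?S \<inter> {..k} = catalan_steps a b k" using that by (auto simp: catalan_steps_def)
    then show ?thesis by (simp add: card_catalan_steps[OF b])
  qed
  have cardS: "card ?S = n * b" using b by (simp add: card_catalan_steps)
  have "(\<forall>k. card (?S \<inter> {..k}) \<le> card (T \<inter> {..k})) \<longleftrightarrow> (\<forall>j<n. j * b \<le> card (T \<inter> {..j * ?d}))"
    if T: "T \<subseteq> {1..?N}" and cardT: "card T = n * b"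
  proof (intro iffI allI impI)
    fix j assume le: "\<forall>k. card (?S \<inter> {..k}) \<le> card (T \<inter> {..k})" and "j < n"
    then have "j * b = card (?S \<inter> {..j * ?d})" using b by (subst S_le) auto
    then show "j * b \<le> card (T \<inter> {..j * ?d})" using le by simp
  next
    fix k assume le: "\<forall>j<n. j * b \<le> card (T \<inter> {..j * ?d})"
    have finT: "finite T" using T finite_subset by blast
    show "card (?S \<inter> {..k}) \<le> card (T \<inter> {..k})"
    proof (cases "k < ?N")
      case False
      then have "?S \<inter> {..k} = ?S" "T \<inter> {..k} = T" using T by (auto simp: catalan_steps_def)
      then show ?thesis by (simp add: cardS cardT)
    next
      case True
      define j r where "j = k div ?d" and "r = k mod ?d"
      have k: "k = j * ?d + r" unfolding j_def r_def by (rule div_mult_mod_eq[symmetric])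
      have r: "r < ?d" using b by (simp add: r_def)
      have j: "j < n" using True b by (simp add: j_def div_less_iff_less_mult)
      have "j * b \<le> card (T \<inter> {..j * ?d})" using le j by blast
      also have "\<dots> \<le> card (T \<inter> {..k})" using finT k by (intro card_mono) auto
      finally have 1: "j * b \<le> card (T \<inter> {..k})" .
      \<comment> \<open>For the last block the bound at its end comes from the cardinality of
        \<open>T\<close>, since the prefix conditions stop at \<open>j < n\<close>.\<close>
      have "Suc j * b \<le> card (T \<inter> {..Suc j * ?d})"
      proof (cases "Suc j < n")
        case False
        then have "Suc j = n" using j by simp
        moreover have "T \<inter> {..?N} = T" using T by auto
        ultimately show ?thesis by (simp add: cardT)
      qed (use le in blast)
      also have "\<dots> \<le> card ((T \<inter> {..k}) \<union> {k<..Suc j * ?d})"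
        using finT by (intro card_mono) auto
      also have "\<dots> \<le> card (T \<inter> {..k}) + card {k<..Suc j * ?d}" by (rule card_Un_le)
      also have "card {k<..Suc j * ?d} = ?d - r" using r k by simp
      finally have "j * b + (r - a) \<le> card (T \<inter> {..k})" using 1 r by (cases "r \<ge> a") auto
      then show ?thesis using True by (simp add: S_le j_def r_def)
    qed
  qed
  then show ?thesis
    unfolding catalan_matroid_def schubert_matroid_def bases_def S cardS snd_conv mem_Collect_eq
    using sorted_list_of_set_dominated_iff[OF finS, of T] finite_subset[of T "{1..?N}"] cardS
    by auto
qed

section \<open>The inequality description, by random rounding\<close>

lemma sum_indicator_atLeastAtMost:
  fixes B :: "nat set"
  assumes "B \<subseteq> {1..N}"
  shows "(\<Sum>i=1..k. indicator B i) = real (card (B \<inter> {..k}))"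
proof -
  have "{1..k} \<inter> B = B \<inter> {..k}" using assms by auto
  then show ?thesis by (simp add: indicator_def)
qed

text \<open>For \<theta> in [0,1) the floor is raised by 1 exactly when \<theta> is at least
  \<open>1 - frac s\<close>, an event of length \<open>frac s\<close>.\<close>

lemma integral_floor_add:
  "integrable lborel (\<lambda>\<theta>. indicator {0..<1} \<theta> * real_of_int \<lfloor>s + \<theta>\<rfloor>)"
  "(LBINT \<theta>. indicator {0..<1} \<theta> * real_of_int \<lfloor>s + \<theta>\<rfloor>) = s"
proof -
  have floor: "\<lfloor>s + \<theta>\<rfloor> = \<lfloor>s\<rfloor> + (if 1 - frac s \<le> \<theta> then 1 else 0)" if "\<theta> \<in> {0..<1}" for \<theta>
    using that by (auto simp: floor_eq_iff frac_def) linarith+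
  have eq: "(\<lambda>\<theta>. indicator {0..<1} \<theta> * real_of_int \<lfloor>s + \<theta>\<rfloor>) =
      (\<lambda>\<theta>. real_of_int \<lfloor>s\<rfloor> * indicator {0..<1} \<theta> + indicator {1 - frac s..<1} \<theta>)"
  proof
    fix \<theta> :: real
    have "frac s < 1" by (rule frac_lt_1)
    then show "indicator {0..<1} \<theta> * real_of_int \<lfloor>s + \<theta>\<rfloor> =
        real_of_int \<lfloor>s\<rfloor> * indicator {0..<1} \<theta> + indicator {1 - frac s..<1} \<theta>"
      by (cases "\<theta> \<in> {0..<1}") (auto simp: floor indicator_def)
  qed
  show "integrable lborel (\<lambda>\<theta>. indicator {0..<1} \<theta> * real_of_int \<lfloor>s + \<theta>\<rfloor>)"
    unfolding eq by (intro Bochner_Integration.integrable_add integrable_mult_right) (auto simp: integrable_indicator_iff)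
  have "(LBINT \<theta>. indicator {0..<1} \<theta> * real_of_int \<lfloor>s + \<theta>\<rfloor>) =
      real_of_int \<lfloor>s\<rfloor> * measure lborel {0..<1::real} + measure lborel {1 - frac s..<1}"
    unfolding eq by (subst Bochner_Integration.integral_add) auto
  also have "\<dots> = s" by (simp add: measure_def frac_def)
  finally show "(LBINT \<theta>. indicator {0..<1} \<theta> * real_of_int \<lfloor>s + \<theta>\<rfloor>) = s" .
qed

text \<open>An expectation for uniform \<theta>, grouped by the finitely many values of
  \<open>f\<close>. The lengths of the level sets become the weights of a convex
  combination.\<close>

lemma sum_measure_level_sets:
  fixes f :: "real \<Rightarrow> 'b" and g :: "'b \<Rightarrow> real"
  assumes fin: "finite F" and range: "\<And>\<theta>. \<theta> \<in> {0..<1} \<Longrightarrow> f \<theta> \<in> F"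
    and meas: "\<And>v. v \<in> F \<Longrightarrow> {\<theta> \<in> {0..<1}. f \<theta> = v} \<in> sets lborel"
  shows "(\<Sum>v\<in>F. measure lborel {\<theta> \<in> {0..<1}. f \<theta> = v} * g v) =
    (LBINT \<theta>. indicator {0..<1} \<theta> * g (f \<theta>))"
proof -
  have finite: "emeasure lborel {\<theta> \<in> {0..<1}. f \<theta> = v} < \<infinity>" for v
  proof -
    have "emeasure lborel {\<theta> \<in> {0..<1}. f \<theta> = v} \<le> emeasure lborel {0..<1::real}"
      by (intro emeasure_mono) auto
    also have "\<dots> < \<infinity>" by simp
    finally show ?thesis .
  qed
  have "(\<Sum>v\<in>F. measure lborel {\<theta> \<in> {0..<1}. f \<theta> = v} * g v) =
      (\<Sum>v\<in>F. LBINT \<theta>. indicator {\<theta> \<in> {0..<1}. f \<theta> = v} \<theta> * g v)"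
    using meas by (intro sum.cong refl) simp
  also have "\<dots> = (LBINT \<theta>. (\<Sum>v\<in>F. indicator {\<theta> \<in> {0..<1}. f \<theta> = v} \<theta> * g v))"
    using meas finite
    by (intro Bochner_Integration.integral_sum[symmetric] integrable_mult_left)
      (auto simp: integrable_indicator_iff)
  also have "\<dots> = (LBINT \<theta>. indicator {0..<1} \<theta> * g (f \<theta>))"
  proof (rule Bochner_Integration.integral_cong[OF refl])
    fix \<theta> :: real
    show "(\<Sum>v\<in>F. indicator {\<theta> \<in> {0..<1}. f \<theta> = v} \<theta> * g v) = indicator {0..<1} \<theta> * g (f \<theta>)"
    proof (cases "\<theta> \<in> {0..<1}")
      case True
      then have "(\<Sum>v\<in>F. indicator {\<theta> \<in> {0..<1}. f \<theta> = v} \<theta> * g v) =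
          (\<Sum>v\<in>F. if f \<theta> = v then g v else 0)"
        by (intro sum.cong refl) (auto simp: indicator_def)
      then show ?thesis using True range fin by (simp add: sum.delta')
    qed (auto simp: indicator_def)
  qed
  finally show ?thesis .
qed

definition catalan_polytope :: "nat \<Rightarrow> nat \<Rightarrow> nat \<Rightarrow> (nat \<Rightarrow> real) set" where
  "catalan_polytope n a b =
    {x. (\<forall>i. i \<notin> {1..n * (a + b)} \<longrightarrow> x i = 0) \<and> (\<forall>i. 0 \<le> x i \<and> x i \<le> 1) \<and>
      (\<Sum>i=1..n * (a + b). x i) = real (n * b) \<and>
      (\<forall>j<n. real (j * b) \<le> (\<Sum>i=1..j * (a + b). x i))}"

text \<open>Each constraint is affine and holds at the basis indicators, so it survives convex
  combinations.\<close>

lemma matroid_polytope_subset_catalan_polytope: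
  assumes b: "b > 0"
  shows "matroid_polytope (catalan_matroid n a b) \<subseteq> catalan_polytope n a b"
proof
  let ?N = "n * (a + b)"
  fix x assume "x \<in> matroid_polytope (catalan_matroid n a b)"
  then obtain F w where F: "finite F" "F \<subseteq> {indicator B | B. B \<in> bases (catalan_matroid n a b)}"
    and w: "\<forall>v\<in>F. 0 \<le> w v" "sum w F = 1" and x: "x = (\<lambda>i. \<Sum>v\<in>F. w v * v i)"
    unfolding matroid_polytope_def conv_def by blast
  have sums: "(\<Sum>i=1..k. x i) = (\<Sum>v\<in>F. w v * (\<Sum>i=1..k. v i))" for k
    unfolding x by (subst sum.swap) (simp add: sum_distrib_left)
  have vertex: "(\<forall>i. i \<notin> {1..?N} \<longrightarrow> v i = 0) \<and> (\<forall>i. 0 \<le> v i \<and> v i \<le> 1) \<and>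
      (\<Sum>i=1..?N. v i) = real (n * b) \<and> (\<forall>j<n. real (j * b) \<le> (\<Sum>i=1..j * (a + b). v i))"
    if "v \<in> F" for v
  proof -
    obtain B where v: "v = indicator B" and B: "B \<in> bases (catalan_matroid n a b)"
      using \<open>v \<in> F\<close> F(2) by auto
    then have B: "B \<subseteq> {1..?N}" "card B = n * b" "\<forall>j<n. j * b \<le> card (B \<inter> {..j * (a + b)})"
      unfolding bases_catalan_matroid[OF b] by auto
    have "B \<inter> {..?N} = B" using B by auto
    then show ?thesis
      unfolding v sum_indicator_atLeastAtMost[OF B(1)] of_nat_le_iff of_nat_eq_iff
      using B by (auto simp: indicator_def)
  qed
  have "x i \<le> 1" for i
  proof -
    have "x i \<le> (\<Sum>v\<in>F. w v * 1)" unfolding x using w vertex by (intro sum_mono mult_left_mono) auto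
    then show ?thesis using w by simp
  qed
  moreover have "0 \<le> x i" for i unfolding x using w vertex by (intro sum_nonneg mult_nonneg_nonneg) auto
  moreover have "x i = 0" if "i \<notin> {1..?N}" for i
    unfolding x using vertex that by (intro sum.neutral) auto
  moreover have "(\<Sum>i=1..?N. x i) = real (n * b)"
  proof -
    have "(\<Sum>i=1..?N. x i) = (\<Sum>v\<in>F. w v * real (n * b))"
      unfolding sums using vertex by (intro sum.cong) auto
    then show ?thesis using w by (simp flip: sum_distrib_right)
  qed
  moreover have "real (j * b) \<le> (\<Sum>i=1..j * (a + b). x i)" if "j < n" for j
  proof -
    have "(\<Sum>v\<in>F. w v * real (j * b)) \<le> (\<Sum>i=1..j * (a + b). x i)"
      unfolding sums using vertex w that by (intro sum_mono mult_left_mono) auto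
    then show ?thesis using w by (simp flip: sum_distrib_right)
  qed
  ultimately show "x \<in> catalan_polytope n a b" unfolding catalan_polytope_def by blast
qed

text \<open>As coordinates lie in [0,1], the rounded prefix sums rise by 0 or 1 at each step and so
  count a set. Rounding respects the integer constraints: a prefix sum of at least jb keeps a floor
  of at least jb after adding \<theta>, and the total nb stays exact because \<theta> is less than
  1.\<close>

lemma catalan_polytope_subset_matroid_polytope:
  assumes b: "b > 0"
  shows "catalan_polytope n a b \<subseteq> matroid_polytope (catalan_matroid n a b)"
proof
  let ?d = "a + b"
  let ?N = "n * ?d"
  fix x assume "x \<in> catalan_polytope n a b"
  then have x_out: "\<And>i. i \<notin> {1..?N} \<Longrightarrow> x i = 0" and x_bd: "\<And>i. 0 \<le> x i" "\<And>i. x i \<le> 1"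
    and x_sum: "(\<Sum>i=1..?N. x i) = real (n * b)"
    and x_pre: "\<And>j. j < n \<Longrightarrow> real (j * b) \<le> (\<Sum>i=1..j * ?d. x i)"
    unfolding catalan_polytope_def by blast+
  define s where "s k = (\<Sum>i=1..k. x i)" for k
  have s_Suc: "s (Suc k) = s k + x (Suc k)" for k by (simp add: s_def)
  define B where "B \<theta> = {k \<in> {1..?N}. \<lfloor>s k + \<theta>\<rfloor> \<noteq> \<lfloor>s (k - 1) + \<theta>\<rfloor>}" for \<theta> :: real
  have ind: "indicator (B \<theta>) k = real_of_int \<lfloor>s k + \<theta>\<rfloor> - real_of_int \<lfloor>s (k - 1) + \<theta>\<rfloor>"
    if k: "k \<in> {1..?N}" for k \<theta>
  proof -
    have "s k = s (k - 1) + x k" using s_Suc[of "k - 1"] k by simp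
    then have le: "s (k - 1) + \<theta> \<le> s k + \<theta>" "s k + \<theta> \<le> s (k - 1) + \<theta> + 1"
      using x_bd[of k] by linarith+
    have "\<lfloor>s (k - 1) + \<theta>\<rfloor> \<le> \<lfloor>s k + \<theta>\<rfloor>" "\<lfloor>s k + \<theta>\<rfloor> \<le> \<lfloor>s (k - 1) + \<theta>\<rfloor> + 1"
      using floor_mono[OF le(1)] floor_mono[OF le(2)] by simp_all
    then have "\<lfloor>s k + \<theta>\<rfloor> = \<lfloor>s (k - 1) + \<theta>\<rfloor> \<or> \<lfloor>s k + \<theta>\<rfloor> = \<lfloor>s (k - 1) + \<theta>\<rfloor> + 1" by linarith
    then show ?thesis using k by (auto simp: B_def indicator_def)
  qed
  have B_sub: "B \<theta> \<subseteq> {1..?N}" for \<theta> by (auto simp: B_def)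
  have card_B: "int (card (B \<theta> \<inter> {..k})) = \<lfloor>s k + \<theta>\<rfloor>" if "k \<le> ?N" "\<theta> \<in> {0..<1}" for k \<theta>
  proof -
    have "(\<Sum>i=1..k. indicator (B \<theta>) i) = real_of_int \<lfloor>s k + \<theta>\<rfloor>" using that(1)
    proof (induction k)
      case 0
      then show ?case using that(2) by (simp add: s_def floor_eq_iff)
    next
      case (Suc k)
      then show ?case using ind[of "Suc k" \<theta>] by simp
    qed
    then show ?thesis unfolding sum_indicator_atLeastAtMost[OF B_sub] by linarith
  qed
  have B_bases: "B \<theta> \<in> bases (catalan_matroid n a b)" if \<theta>: "\<theta> \<in> {0..<1}" for \<theta>
  proof -
    have "card (B \<theta> \<inter> {..?N}) = n * b"
    proof -
      have "\<lfloor>s ?N + \<theta>\<rfloor> = int (n * b)" unfolding s_def x_sum using \<theta> by (intro floor_unique) simp_all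
      then show ?thesis using card_B[of ?N \<theta>] \<theta> by (simp only: order_refl of_nat_eq_iff)
    qed
    moreover have "B \<theta> \<inter> {..?N} = B \<theta>" using B_sub[of \<theta>] by auto
    moreover have "j * b \<le> card (B \<theta> \<inter> {..j * ?d})" if "j < n" for j
    proof -
      have "int (j * b) \<le> \<lfloor>s (j * ?d) + \<theta>\<rfloor>"
        using x_pre[OF that] \<theta> by (simp add: le_floor_iff s_def)
      moreover have "j * ?d \<le> ?N" using that by (intro mult_le_mono1) simp
      then have "int (card (B \<theta> \<inter> {..j * ?d})) = \<lfloor>s (j * ?d) + \<theta>\<rfloor>" using card_B \<theta> by blast
      ultimately show ?thesis by linarith
    qed
    ultimately show ?thesis unfolding bases_catalan_matroid[OF b] using B_sub[of \<theta>] by simp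
  qed
  define f where "f \<theta> = (indicator (B \<theta>) :: nat \<Rightarrow> real)" for \<theta>
  define F where "F = f ` {0..<1}"
  \<comment> \<open>The probability that rounding produces the vertex \<open>v\<close>.\<close>
  define w where "w v = measure lborel {\<theta> \<in> {0..<1}. f \<theta> = v}" for v
  have "F \<subseteq> indicator ` Pow {1..?N}" using B_sub by (auto simp: F_def f_def)
  then have fin: "finite F" by (rule finite_subset) simp
  have meas: "{\<theta> \<in> {0..<1}. f \<theta> = v} \<in> sets lborel" if "v \<in> F" for v
  proof -
    obtain C where v: "v = indicator C" and C: "C \<subseteq> {1..?N}"
      using \<open>v \<in> F\<close> B_sub by (auto simp: F_def f_def)
    have "{\<theta> \<in> {0..<1}. f \<theta> = v} = {\<theta> \<in> {0..<1}. B \<theta> = C}"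
      by (simp add: f_def v fun_eq_iff indicator_def set_eq_iff) blast
    also have "\<dots> = {0..<1} \<inter> {\<theta> \<in> space lborel.
        \<forall>k\<in>{1..?N}. (\<lfloor>s k + \<theta>\<rfloor> \<noteq> \<lfloor>s (k - 1) + \<theta>\<rfloor>) \<longleftrightarrow> k \<in> C}"
      using C by (auto simp: B_def)
    also have "\<dots> \<in> sets lborel" by measurable
    finally show ?thesis .
  qed
  have level: "(\<Sum>v\<in>F. w v * g v) = (LBINT \<theta>. indicator {0..<1} \<theta> * g (f \<theta>))" for g
    unfolding w_def by (rule sum_measure_level_sets[OF fin _ meas]) (auto simp: F_def)
  have "sum w F = 1"
    using level[of "\<lambda>_. 1"] by (simp add: measure_def)
  moreover have "x = (\<lambda>i. \<Sum>v\<in>F. w v * v i)"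
  proof
    fix i
    show "x i = (\<Sum>v\<in>F. w v * v i)"
    proof (cases "i \<in> {1..?N}")
      case True
      \<comment> \<open>The expected indicator at \<open>i\<close> is the difference of two expected
        rounded prefix sums, which are the prefix sums themselves.\<close>
      have "(\<Sum>v\<in>F. w v * v i) = (LBINT \<theta>. indicator {0..<1} \<theta> * real_of_int \<lfloor>s i + \<theta>\<rfloor> -
          indicator {0..<1} \<theta> * real_of_int \<lfloor>s (i - 1) + \<theta>\<rfloor>)"
        unfolding level[of "\<lambda>v. v i"] f_def ind[OF True] by (simp add: right_diff_distrib)
      also have "\<dots> = s i - s (i - 1)"
        by (subst Bochner_Integration.integral_diff) (auto simp: integral_floor_add)
      also have "\<dots> = x i" using s_Suc[of "i - 1"] True by simp
      finally show ?thesis by simp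
    next
      case False
      then have "i \<notin> B \<theta>" for \<theta> using B_sub by blast
      then have "v i = 0" if "v \<in> F" for v using that by (auto simp: F_def f_def)
      then show ?thesis using x_out[OF False] by (simp add: sum.neutral)
    qed
  qed
  moreover have "F \<subseteq> {indicator B | B. B \<in> bases (catalan_matroid n a b)}"
    using B_bases by (auto simp: F_def f_def)
  moreover have "\<forall>v\<in>F. 0 \<le> w v" by (simp add: w_def)
  ultimately show "x \<in> matroid_polytope (catalan_matroid n a b)"
    unfolding matroid_polytope_def conv_def using fin by blast
qed

lemma matroid_polytope_catalan:
  "b > 0 \<Longrightarrow> matroid_polytope (catalan_matroid n a b) = catalan_polytope n a b"
  using matroid_polytope_subset_catalan_polytope catalan_polytope_subset_matroid_polytope by blast

subsection \<open>The volume\<close>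

text \<open>Without a carry the fractional part grows by \<open>x\<close>; with a carry it changes
  by \<open>x - 1\<close>, which is negative.\<close>

lemma floor_add_eq:
  fixes s x :: real
  assumes "0 \<le> x" "x < 1"
  shows "\<lfloor>s + x\<rfloor> = \<lfloor>s\<rfloor> + (if frac (s + x) < frac s then 1 else 0)"
proof -
  have "s = of_int \<lfloor>s\<rfloor> + frac s" "s + x = of_int \<lfloor>s + x\<rfloor> + frac (s + x)"
    by (simp_all add: frac_def)
  moreover have "\<lfloor>s\<rfloor> \<le> \<lfloor>s + x\<rfloor>" "\<lfloor>s + x\<rfloor> \<le> \<lfloor>s\<rfloor> + 1"
    using assms by linarith+
  then have "\<lfloor>s + x\<rfloor> = \<lfloor>s\<rfloor> \<or> \<lfloor>s + x\<rfloor> = \<lfloor>s\<rfloor> + 1" by linarith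
  ultimately show ?thesis using assms by (auto simp: frac_def)
qed

lemma floor_sum_eq_ndesc:
  assumes x: "x \<in> unit_cube m" and "k \<le> m"
  shows "\<lfloor>\<Sum>i=1..k. x i\<rfloor> = int (ndesc (frac_sums m x) k)"
  using \<open>k \<le> m\<close>
proof (induction k)
  case (Suc k)
  have xk: "0 \<le> x (Suc k)" "x (Suc k) < 1" using x Suc.prems by (auto simp: unit_cube_def PiE_iff)
  have sum: "(\<Sum>i=1..Suc k. x i) = (\<Sum>i=1..k. x i) + x (Suc k)" by simp
  \<comment> \<open>The first step is separate: \<open>frac_sums\<close> is \<open>undefined\<close>
    at 0, and a single coordinate in [0,1) has floor 0.\<close>
  show ?case
  proof (cases "k = 0")
    case True
    then show ?thesis using xk by (simp add: ndesc_Suc floor_eq_iff)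
  next
    case False
    then have "frac_sums m x (Suc k) = frac (\<Sum>i=1..Suc k. x i)" "frac_sums m x k = frac (\<Sum>i=1..k. x i)"
      using Suc.prems unfolding frac_sums_def by simp_all
    then show ?thesis
      using Suc floor_add_eq[OF xk, of "\<Sum>i=1..k. x i"] False unfolding sum ndesc_Suc by simp
  qed
qed simp

lemma ndesc_order_cell:
  assumes "y \<in> order_cell m p" "k \<le> m"
  shows "ndesc y k = ndesc p k"
proof -
  have "{i \<in> {1..<k}. y (Suc i) < y i} = {i \<in> {1..<k}. p (Suc i) < p i}"
    using assms by (intro Collect_cong conj_cong refl) (auto simp: order_cell_def)
  then show ?thesis by (simp add: ndesc_def)
qed

lemma ndesc_measurable:
  assumes "k \<le> m"
  shows "(\<lambda>y. real (ndesc y k)) \<in> borel_measurable (cube_measure m)"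
proof -
  have "(\<lambda>y. real (ndesc y k)) = (\<lambda>y. \<Sum>i\<in>{1..<k}. if y (Suc i) < y i then 1 else 0)"
    unfolding ndesc_def by (subst card_filter_eq_sum) (auto intro!: ext sum.cong)
  also have "\<dots> \<in> borel_measurable (cube_measure m)"
  proof (rule borel_measurable_sum)
    fix i assume "i \<in> {1..<k}"
    then have [measurable]: "(\<lambda>y. y i) \<in> borel_measurable (cube_measure m)"
        "(\<lambda>y. y (Suc i)) \<in> borel_measurable (cube_measure m)"
      using assms by (auto intro!: measurable_component_singleton[where M = "\<lambda>_. lborel", simplified])
    show "(\<lambda>y. if y (Suc i) < y i then 1 else 0 :: real) \<in> borel_measurable (cube_measure m)"
      by measurable
  qed
  finally show ?thesis .
qed

section \<open>The projected polytope and its volume\<close>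

text \<open>The dropped coordinate equals nb minus the remaining sum, so its bounds 0 and 1 become
  the two bounds on that sum. Here \<open>d\<close> stands for a + b.\<close>

definition projected_polytope :: "nat \<Rightarrow> nat \<Rightarrow> nat \<Rightarrow> nat \<Rightarrow> (nat \<Rightarrow> real) set" where
  "projected_polytope n d b m =
    {x \<in> extensional {1..m}. (\<forall>i\<in>{1..m}. 0 \<le> x i \<and> x i \<le> 1) \<and>
      real (n * b) - 1 \<le> (\<Sum>i=1..m. x i) \<and> (\<Sum>i=1..m. x i) \<le> real (n * b) \<and>
      (\<forall>j<n. real (j * b) \<le> (\<Sum>i=1..j * d. x i))}"

text \<open>Ensures that no prefix constraint involves the dropped coordinate.\<close>

lemma mult_le_if_mult_eq_Suc:
  fixes j n d m :: nat
  assumes "n * d = m + 1" "j < n"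
  shows "j * d \<le> m"
proof -
  have "d > 0" using assms by (auto intro: Nat.gr0I)
  then have "j * d < n * d" using assms(2) by simp
  then show ?thesis using assms(1) by linarith
qed

lemma restrict_catalan_polytope:
  assumes N: "n * (a + b) = m + 1"
  shows "(\<lambda>x. restrict x {1..m}) ` catalan_polytope n a b = projected_polytope n (a + b) b m"
proof -
  have split: "(\<Sum>i=1..m + 1. x i) = (\<Sum>i=1..m. x i) + x (m + 1)" for x :: "nat \<Rightarrow> real"
    by (simp flip: Suc_eq_plus1)
  have restr: "(\<Sum>i=1..k. restrict x {1..m} i) = (\<Sum>i=1..k. x i)" if "k \<le> m" for x :: "nat \<Rightarrow> real" and k
    using that by (intro sum.cong) auto
  show ?thesis
  proof (intro equalityI subsetI)
    fix y assume "y \<in> (\<lambda>x. restrict x {1..m}) ` catalan_polytope n a b"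
    then obtain x where x: "x \<in> catalan_polytope n a b" and y: "y = restrict x {1..m}" by blast
    have bd: "0 \<le> x i" "x i \<le> 1" for i using x by (auto simp: catalan_polytope_def)
    have "(\<Sum>i=1..m. x i) + x (m + 1) = real (n * b)"
      using x unfolding catalan_polytope_def N split by blast
    then have "real (n * b) - 1 \<le> (\<Sum>i=1..m. y i)" "(\<Sum>i=1..m. y i) \<le> real (n * b)"
      using bd[of "m + 1"] unfolding y restr[OF order_refl] by linarith+
    moreover have "\<forall>i\<in>{1..m}. 0 \<le> y i \<and> y i \<le> 1" "y \<in> extensional {1..m}"
      using bd by (simp_all add: y)
    moreover have "real (j * b) \<le> (\<Sum>i=1..j * (a + b). y i)" if "j < n" for j
      unfolding y restr[OF mult_le_if_mult_eq_Suc[OF N that]] using x that by (auto simp: catalan_polytope_def)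
    ultimately show "y \<in> projected_polytope n (a + b) b m"
      unfolding projected_polytope_def by blast
  next
    fix y assume y: "y \<in> projected_polytope n (a + b) b m"
    \<comment> \<open>Restores the dropped coordinate from the equation for the total sum.\<close>
    define x where "x i = (if i \<in> {1..m} then y i else if i = m + 1 then real (n * b) - (\<Sum>i=1..m. y i) else 0)" for i
    have sums: "(\<Sum>i=1..k. x i) = (\<Sum>i=1..k. y i)" if "k \<le> m" for k
      using that by (intro sum.cong) (auto simp: x_def)
    have "(\<Sum>i=1..m + 1. x i) = real (n * b)"
      unfolding split sums[OF order_refl] by (simp add: x_def)
    moreover have "0 \<le> x i \<and> x i \<le> 1" for i
      using y by (auto simp: x_def projected_polytope_def)
    moreover have "x i = 0" if "i \<notin> {1..m + 1}" for i
      using that by (auto simp: x_def)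
    moreover have "real (j * b) \<le> (\<Sum>i=1..j * (a + b). x i)" if "j < n" for j
      unfolding sums[OF mult_le_if_mult_eq_Suc[OF N that]] using y that by (auto simp: projected_polytope_def)
    ultimately have "x \<in> catalan_polytope n a b" unfolding catalan_polytope_def N by blast
    moreover have "y = restrict x {1..m}"
      using y by (auto simp: fun_eq_iff x_def projected_polytope_def extensional_def)
    ultimately show "y \<in> (\<lambda>x. restrict x {1..m}) ` catalan_polytope n a b" by blast
  qed
qed

lemma sum_measurable:
  assumes "k \<le> m"
  shows "(\<lambda>x. \<Sum>i=1..k. x i :: real) \<in> borel_measurable (cube_measure m)"
  using assms by (intro borel_measurable_sum measurable_component_singleton[where M = "\<lambda>_. lborel", simplified]) auto

lemma AE_cube_measure_coordinate_neq:
  assumes "i \<in> {1..m}"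
  shows "AE x in cube_measure m. x i \<noteq> c"
proof (rule AE_I'[of "{x \<in> space (cube_measure m). x i = c}"])
  show "{x \<in> space (cube_measure m). x i = c} \<in> null_sets (cube_measure m)"
  proof (rule null_sets_PiM_countable_sections)
    show "{x \<in> space (cube_measure m). x i = c} \<in> sets (cube_measure m)"
      using assms by measurable
    fix x :: "nat \<Rightarrow> real"
    have "{t. x(i := t) \<in> {x \<in> space (cube_measure m). x i = c}} \<subseteq> {c}" by auto
    then show "countable {t. x(i := t) \<in> {x \<in> space (cube_measure m). x i = c}}"
      by (rule countable_subset) auto
  qed (use assms in auto)
qed auto

lemma AE_cube_measure_sum_neq:
  assumes "m > 0"
  shows "AE x in cube_measure m. (\<Sum>i=1..m. x i) \<noteq> c"
proof (rule AE_I'[of "{x \<in> space (cube_measure m). (\<Sum>i=1..m. x i) = c}"])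
  note [measurable] = sum_measurable[of m m]
  show "{x \<in> space (cube_measure m). (\<Sum>i=1..m. x i) = c} \<in> null_sets (cube_measure m)"
  proof (rule null_sets_PiM_countable_sections)
    show "{x \<in> space (cube_measure m). (\<Sum>i=1..m. x i) = c} \<in> sets (cube_measure m)"
      by measurable
    fix x :: "nat \<Rightarrow> real"
    have "(\<Sum>i=1..m. (x(m := t)) i) = (\<Sum>i\<in>{1..m} - {m}. x i) + t" for t
      using assms by (subst sum.remove[of _ m]) auto
    then have "{t. x(m := t) \<in> {x \<in> space (cube_measure m). (\<Sum>i=1..m. x i) = c}} \<subseteq>
        {c - (\<Sum>i\<in>{1..m} - {m}. x i)}" by auto
    then show "countable {t. x(m := t) \<in> {x \<in> space (cube_measure m). (\<Sum>i=1..m. x i) = c}}"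
      by (rule countable_subset) auto
  qed (use assms in auto)
qed auto

text \<open>Up to null sets the polytope is the preimage of \<open>E\<close> under
  \<open>frac_sums\<close>, because its constraints have integer bounds and can be read off from
  floors of prefix sums. Membership in \<open>E\<close> depends only on descents, so it is constant
  on order cells.\<close>

lemma measure_projected_polytope:
  assumes m: "m > 0" and N: "n * d = m + 1"
  shows "measure (cube_measure m) (projected_polytope n d b m) =
    card {p. p permutes {1..m} \<and> ndesc p m + 1 = n * b \<and> (\<forall>j<n. j * b \<le> ndesc p (j * d))} / fact m"
proof -
  let ?Q = "\<lambda>f. ndesc f m + 1 = n * b \<and> (\<forall>j<n. j * b \<le> ndesc f (j * d))"
  define E where "E = {y \<in> space (cube_measure m). real (ndesc y m) + 1 = real (n * b) \<and>
    (\<forall>j\<in>{..<n}. real (j * b) \<le> real (ndesc y (j * d)))}"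
  have le: "j * d \<le> m" if "j < n" for j using mult_le_if_mult_eq_Suc[OF N that] .
  have le': "j * d \<le> m" if "j \<in> {..<n}" for j using that by (intro le) simp
  have E_iff: "y \<in> E \<longleftrightarrow> y \<in> space (cube_measure m) \<and> ?Q y" for y :: "nat \<Rightarrow> real"
  proof -
    have "real (ndesc y m) + 1 = real (n * b) \<longleftrightarrow> ndesc y m + 1 = n * b" by linarith
    then show ?thesis unfolding E_def by (auto simp only: mem_Collect_eq of_nat_le_iff lessThan_iff Ball_def)
  qed
  have E: "E \<in> sets (cube_measure m)"
  proof -
    have [measurable]: "Measurable.pred (cube_measure m) (\<lambda>y. real (ndesc y m) + 1 = real (n * b))"
      using ndesc_measurable[of m m] by measurable
    have [measurable]: "Measurable.pred (cube_measure m) (\<lambda>y. real (j * b) \<le> real (ndesc y (j * d)))"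
      if "j \<in> {..<n}" for j
      using ndesc_measurable[OF le'[OF that]] by measurable
    show ?thesis unfolding E_def by measurable
  qed
  have D: "projected_polytope n d b m \<in> sets (cube_measure m)"
  proof -
    have [measurable]: "Measurable.pred (cube_measure m) (\<lambda>x. real (j * b) \<le> (\<Sum>i=1..j * d. x i))"
      if "j \<in> {..<n}" for j
      using sum_measurable[OF le'[OF that]] by measurable
    note [measurable] = sum_measurable[of m m]
    have "projected_polytope n d b m = {x \<in> space (cube_measure m).
      (\<forall>i\<in>{1..m}. 0 \<le> x i \<and> x i \<le> 1) \<and>
      real (n * b) - 1 \<le> (\<Sum>i=1..m. x i) \<and> (\<Sum>i=1..m. x i) \<le> real (n * b) \<and>
      (\<forall>j\<in>{..<n}. real (j * b) \<le> (\<Sum>i=1..j * d. x i))}"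
      by (auto simp: projected_polytope_def space_PiM PiE_iff)
    also have "\<dots> \<in> sets (cube_measure m)" by measurable
    finally show ?thesis .
  qed
  have D': "{x \<in> unit_cube m. frac_sums m x \<in> E} \<in> sets (cube_measure m)"
  proof -
    have "{x \<in> unit_cube m. frac_sums m x \<in> E} =
        unit_cube m \<inter> (frac_sums m -` E \<inter> space (cube_measure m))"
      using unit_cube_subset_space by blast
    also have "\<dots> \<in> sets (cube_measure m)" using E by measurable
    finally show ?thesis .
  qed
  \<comment> \<open>Two boundary sets are discarded: coordinates equal to 1, which separate the
    closed cube from \<open>unit_cube\<close>, and the total nb, whose floor is nb instead of nb -
    1.\<close>
  have "AE x in cube_measure m. \<forall>i\<in>{1..m}. x i \<noteq> 1"
    by (intro AE_finite_allI AE_cube_measure_coordinate_neq) auto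
  then have "AE x in cube_measure m. x \<in> projected_polytope n d b m \<longleftrightarrow>
      x \<in> {x \<in> unit_cube m. frac_sums m x \<in> E}"
    using AE_cube_measure_sum_neq[OF m, of "real (n * b)"] AE_space
  proof eventually_elim
    case (elim x)
    then have ext: "x \<in> extensional {1..m}" by (simp add: space_PiM PiE_iff)
    have cube: "x \<in> unit_cube m \<longleftrightarrow> (\<forall>i\<in>{1..m}. 0 \<le> x i \<and> x i \<le> 1)"
      using elim(1) ext by (auto simp: unit_cube_def PiE_iff order_less_le)
    have fs: "frac_sums m x \<in> space (cube_measure m)"
      using measurable_space[OF frac_sums_measurable elim(3)] .
    show ?case
    proof (cases "x \<in> unit_cube m")
      case False
      then show ?thesis using cube by (auto simp: projected_polytope_def)
    next
      case True
      have "real (n * b) - 1 \<le> (\<Sum>i=1..m. x i) \<and> (\<Sum>i=1..m. x i) \<le> real (n * b) \<longleftrightarrow>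
          \<lfloor>\<Sum>i=1..m. x i\<rfloor> = int (n * b) - 1"
        using elim(2) by (auto simp: floor_eq_iff)
      also have "\<dots> \<longleftrightarrow> ndesc (frac_sums m x) m + 1 = n * b"
        unfolding floor_sum_eq_ndesc[OF True order_refl] by linarith
      finally have 1: "real (n * b) - 1 \<le> (\<Sum>i=1..m. x i) \<and> (\<Sum>i=1..m. x i) \<le> real (n * b) \<longleftrightarrow>
          ndesc (frac_sums m x) m + 1 = n * b" .
      have 2: "real (j * b) \<le> (\<Sum>i=1..j * d. x i) \<longleftrightarrow> j * b \<le> ndesc (frac_sums m x) (j * d)"
        if "j < n" for j
      proof -
        have "real (j * b) \<le> (\<Sum>i=1..j * d. x i) \<longleftrightarrow> int (j * b) \<le> \<lfloor>\<Sum>i=1..j * d. x i\<rfloor>"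
          by (simp add: le_floor_iff)
        then show ?thesis unfolding floor_sum_eq_ndesc[OF True le[OF that]] of_nat_le_iff .
      qed
      show ?thesis
        unfolding projected_polytope_def mem_Collect_eq E_iff using ext True cube 1 2 fs by blast
    qed
  qed
  then have "emeasure (cube_measure m) (projected_polytope n d b m) =
      emeasure (cube_measure m) {x \<in> unit_cube m. frac_sums m x \<in> E}"
    using D D' by (rule emeasure_eq_AE)
  then have "measure (cube_measure m) (projected_polytope n d b m) =
      measure (cube_measure m) {x \<in> unit_cube m. frac_sums m x \<in> E}"
    by (simp only: measure_def)
  also have "\<dots> = measure (cube_measure m) (unit_cube m \<inter> E)"
    using E by (rule measure_frac_sums_vimage)
  also have "\<dots> = card {p. p permutes {1..m} \<and> ?Q p} / fact m"
  proof (rule measure_order_invariant[OF E])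
    fix p y assume "p permutes {1..m}" and y: "y \<in> order_cell m p"
    have "y \<in> space (cube_measure m)"
      using y unit_cube_subset_space by (auto simp: order_cell_def)
    then show "y \<in> E \<longleftrightarrow> ?Q p"
      unfolding E_iff using ndesc_order_cell[OF y] le by simp
  qed
  finally show ?thesis .
qed

theorem corollary4p3:
  fixes a b n :: nat
  assumes "a > 0" and "b > 0" and "n > 0"
  shows "hyperplane_volume (n * (a + b)) (matroid_polytope (catalan_matroid n a b)) =
    1 / (real n * fact (n * (a + b) - 1)) * real (eulerian (n * (a + b) - 1) (n * b))"
proof -
  define m where "m = n * (a + b) - 1"
  \<comment> \<open>N is at least 2, so at least one coordinate survives the projection.\<close>
  have "1 * 2 \<le> n * (a + b)" using assms by (intro mult_le_mono) auto
  then have m: "m > 0" and N: "n * (a + b) = m + 1" by (auto simp: m_def)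
  let ?c = "card {p. p permutes {1..m} \<and> ndesc p m + 1 = n * b \<and> (\<forall>j<n. j * b \<le> ndesc p (j * (a + b)))}"
  have "hyperplane_volume (n * (a + b)) (matroid_polytope (catalan_matroid n a b)) =
      measure (cube_measure m) (projected_polytope n (a + b) b m)"
    unfolding hyperplane_volume_def matroid_polytope_catalan[OF \<open>b > 0\<close>]
      m_def[symmetric] restrict_catalan_polytope[OF N] ..
  also have "\<dots> = real ?c / fact m" by (rule measure_projected_polytope[OF m N])
  also have "\<dots> = 1 / (real n * fact m) * real (n * ?c)" using assms(3) by simp
  also have "n * ?c = eulerian m (n * b)" by (rule card_ballot_permutations[OF m N])
  finally show ?thesis unfolding m_def .
qed

end
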